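(* Let $d\ge2$ be even and $n\ge1$. The set $\mathbf A^+$ is open in $\mathbb S^{n^d}$.
   Context: All tensors are real. $\mathbb R^{n^d}$ is the space of $d$-th order $n$-dimensional tensors with entrywise inner product $\langle\cdot,\cdot\rangle$ and Frobenius norm; $\mathbb S^{n^d}$ is the subspace of symmetric tensors (entries invariant under all permutations of the indices). $\mathrm{Sym}(\mathcal B)$ is the average of $\mathcal B$ over all $d!$ permutations of its indices. For even $d$, $\mathrm{Mat}(\mathcal B)\in\mathbb R^{n^{d/2}\times n^{d/2}}$ is the reshaping of $\mathcal B$ with rows indexed by the first $d/2$ indices and columns by the last $d/2$ indices (enumerated in the same way). $C=\{\mathcal X\in\mathbb R^{n^d}\mid \operatorname{rank}(\mathrm{Mat}(\mathcal X))=1,\ \mathrm{Mat}(\mathcal X)\text{ symmetric},\ \operatorname{tr}(\mathrm{Mat}(\mathcal X))=1\}$. For $\mathcal A\in\mathbb S^{n^d}$, the KKT system is: $\mathcal X^*\in C$, $\mathcal Y^*\in\mathbb S^{n^d}$, $\Lambda^*\in\mathbb R^{n^d}$ with $\langle-\Lambda^*,\mathcal X-\mathcal X^*\rangle\ge0$ for all $\mathcal X\in C$; $\mathrm{Sym}(\Lambda^* )=\mathcal A$; $\mathcal X^*=\mathcal Y^*$. $\mathbf A$ is the set of all $\mathcal A\in\mathbb S^{n^d}$ for which the KKT system has a solution. $\mathbf A^+$ is the set of all $\mathcal A\in\mathbf A$ for which the KKT system has a solution $\{\mathcal X^*,\mathcal Y^*,\Lambda^*\}$ with $\mathrm{Mat}(\Lambda^*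 )$ symmetric and the leading (largest) eigenvalue of $\mathrm{Mat}(\Lambda^* )$ simple. *)

theory Defs
  imports "HOL-Analysis.Analysis" "HOL-Computational_Algebra.Polynomial"
begin

text \<open>
  The type \<open>'d\<close> is the set of index positions (so the order is \<open>CARD('d)\<close>) and \<open>'n\<close> is the set of
  index values (so the dimension is \<open>CARD('n)\<close>). A multi-index is a function \<open>'d \<Rightarrow> 'n\<close>, and the
  inner product, norm and topology of \<open>real ^ ('d \<Rightarrow> 'n)\<close> are the entrywise (Frobenius) ones.

  An even order \<open>d \<ge> 2\<close> is represented by \<open>'d = 'k + 'k\<close> with \<open>CARD('k) = d div 2\<close>: the positions
  \<open>Inl _\<close> are the first \<open>d/2\<close> ones and the positions \<open>Inr _\<close> the last \<open>d/2\<close> ones, matched to each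
  other through \<open>'k\<close>. Since \<open>'k\<close> and \<open>'n\<close> range over all finite types, which are nonempty,
  all even \<open>d \<ge> 2\<close> and all \<open>n \<ge> 1\<close> are covered.
\<close>

type_synonym ('d, 'n) tensor = "(real, 'd \<Rightarrow> 'n) vec"

definition symmetric_tensors :: "('d::finite, 'n::finite) tensor set" where
  "symmetric_tensors = {B. \<forall>p i. p permutes UNIV \<longrightarrow> B $ (i \<circ> p) = B $ i}"

definition tensor_Sym :: "('d::finite, 'n::finite) tensor \<Rightarrow> ('d, 'n) tensor" where
  "tensor_Sym B = (\<chi> i. (\<Sum>p | p permutes (UNIV :: 'd set). B $ (i \<circ> p)) / fact CARD('d))"

definition tensor_Mat ::
    "('k::finite + 'k, 'n::finite) tensor \<Rightarrow> real ^ ('k \<Rightarrow> 'n) ^ ('k \<Rightarrow> 'n)" where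
  "tensor_Mat B = (\<chi> r c. B $ (case_sum r c))"

definition symmetric_matrix :: "real ^ 'm ^ 'm \<Rightarrow> bool" where
  "symmetric_matrix M \<longleftrightarrow> transpose M = M"

definition eigenvalue :: "real ^ 'm ^ 'm \<Rightarrow> real \<Rightarrow> bool" where
  "eigenvalue M \<mu> \<longleftrightarrow> (\<exists>v. v \<noteq> 0 \<and> M *v v = \<mu> *\<^sub>R v)"

definition char_poly :: "real ^ 'm ^ 'm \<Rightarrow> real poly" where
  "char_poly M = det (\<chi> i j. (if i = j then [:0, 1:] else 0) - [:M $ i $ j:])"

definition leading_eigenvalue :: "real ^ 'm ^ 'm \<Rightarrow> real \<Rightarrow> bool" where
  "leading_eigenvalue M \<mu> \<longleftrightarrow> eigenvalue M \<mu> \<and> (\<forall>\<nu>. eigenvalue M \<nu> \<longrightarrow> \<nu> \<le> \<mu>)"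

text \<open>Simple means of algebraic multiplicity one.\<close>

definition simple_eigenvalue :: "real ^ 'm ^ 'm \<Rightarrow> real \<Rightarrow> bool" where
  "simple_eigenvalue M \<mu> \<longleftrightarrow> eigenvalue M \<mu> \<and> order \<mu> (char_poly M) = 1"

definition feasible_set :: "('k::finite + 'k, 'n::finite) tensor set" where
  "feasible_set = {X. rank (tensor_Mat X) = 1 \<and> symmetric_matrix (tensor_Mat X)
                      \<and> trace (tensor_Mat X) = 1}"

definition KKT_solution ::
    "('k::finite + 'k, 'n::finite) tensor \<Rightarrow> ('k + 'k, 'n) tensor \<Rightarrow> ('k + 'k, 'n) tensor
      \<Rightarrow> ('k + 'k, 'n) tensor \<Rightarrow> bool" where
  "KKT_solution A X Y L \<longleftrightarrow>
     X \<in> feasible_set \<and> Y \<in> symmetric_tensors \<and>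
     (\<forall>Z \<in> feasible_set. (- L) \<bullet> (Z - X) \<ge> 0) \<and>
     tensor_Sym L = A \<and> X = Y"

definition KKT_tensors :: "('k::finite + 'k, 'n::finite) tensor set" where
  "KKT_tensors = {A \<in> symmetric_tensors. \<exists>X Y L. KKT_solution A X Y L}"

definition KKT_tensors_plus :: "('k::finite + 'k, 'n::finite) tensor set" where
  "KKT_tensors_plus = {A \<in> KKT_tensors. \<exists>X Y L. KKT_solution A X Y L \<and>
     symmetric_matrix (tensor_Mat L) \<and>
     (\<exists>\<mu>. leading_eigenvalue (tensor_Mat L) \<mu> \<and> simple_eigenvalue (tensor_Mat L) \<mu>)}"

end

theory Submission
  imports Defs
begin

text \<open>
  Let \<open>A\<close> be in \<open>A\<^sup>+\<close> with certificate \<open>L\<close>. Feasible points that are symmetric tensors have the form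
  \<open>x \<otimes> \<dots> \<otimes> x\<close>, and simplicity of the leading eigenvalue \<open>\<mu>\<close> of \<open>L\<close> gives a spectral gap
  \<open>\<gamma> > 0\<close>, so that \<open>\<langle>A, z\<^sup>d\<rangle> = \<langle>L, z\<^sup>d\<rangle> \<le> \<mu> - \<gamma> (1 - \<bar>\<langle>z, x\<rangle>\<bar>)\<close> for unit \<open>z\<close>. Hence maximizers \<open>x'\<close> of
  \<open>\<langle>B, z\<^sup>d\<rangle>\<close> on the sphere converge, up to sign, to \<open>x\<close> as \<open>B \<rightarrow> A\<close>. The tensor \<open>L + (B - A)\<close> has
  symmetrization \<open>B\<close>. Expand it in the projections \<open>x' x'\<^sup>T\<close> and \<open>I - x' x'\<^sup>T\<close> at each position and
  permute the positions in each component so that \<open>x' \<otimes> \<dots> \<otimes> x'\<close> becomes an eigenvector; the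
  components obstructing this vanish after symmetrization because \<open>x'\<close> is a critical point. The
  result depends continuously on \<open>x'\<close> and equals \<open>L\<close> at \<open>B = A\<close>, so for \<open>B\<close> near \<open>A\<close> it keeps the
  spectral gap and certifies \<open>B \<in> A\<^sup>+\<close>.
\<close>

section \<open>Simple leading eigenvalues and spectral gaps\<close>

lemma poly_char_poly: "poly (char_poly M) t = det (t *\<^sub>R mat 1 - M)"
proof -
  have "poly (of_int (sign p)) t = (of_int (sign p) :: real)" for p :: "'a \<Rightarrow> 'a"
    by (simp add: sign_def)
  then show ?thesis
    unfolding char_poly_def det_def
    by (simp add: poly_sum poly_prod mat_def if_distrib[of "\<lambda>q. poly q t"] cong: if_cong)
       (auto intro!: sum.cong prod.cong)
qed

lemma det_eq_0_iff_kernel: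
  fixes A :: "real ^ 'm ^ 'm"
  shows "det A = 0 \<longleftrightarrow> (\<exists>x. x \<noteq> 0 \<and> A *v x = 0)"
  using invertible_det_nz[of A] invertible_left_inverse[of A] matrix_left_invertible_ker[of A] by auto

lemma eigenvalue_iff_det: "eigenvalue M \<mu> \<longleftrightarrow> det (\<mu> *\<^sub>R mat 1 - M) = 0"
proof -
  have "(\<mu> *\<^sub>R mat 1 - M) *v v = 0 \<longleftrightarrow> M *v v = \<mu> *\<^sub>R v" for v
    by (auto simp: matrix_vector_mult_diff_rdistrib scaleR_matrix_vector_assoc[symmetric])
  then show ?thesis
    unfolding eigenvalue_def det_eq_0_iff_kernel by auto
qed

section \<open>Rayleigh quotients of symmetric matrices\<close>

lemma symmetric_matrix_inner:
  assumes "symmetric_matrix M"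
  shows "u \<bullet> (M *v w) = w \<bullet> (M *v u)"
  by (metis assms dot_lmul_matrix inner_commute symmetric_matrix_def vector_transpose_matrix)

text \<open>The form \<mu> (u \<bullet> u) - u \<bullet> M u is nonnegative and vanishes at
  \<open>v\<close>. Moving from \<open>v\<close> along the residual w = \<mu> v - M v changes it to
  first order by 2 t (w \<bullet> w), which would be negative for small negative \<open>t\<close>
  unless w = 0.\<close>

lemma rayleigh_max_eigenvector:
  fixes M :: "real ^ 'm ^ 'm"
  assumes sym: "symmetric_matrix M"
    and bound: "\<And>u. u \<bullet> (M *v u) \<le> \<mu> * (u \<bullet> u)"
    and attained: "v \<bullet> (M *v v) = \<mu> * (v \<bullet> v)"
  shows "M *v v = \<mu> *\<^sub>R v"
proof (rule ccontr)
  define w where "w = \<mu> *\<^sub>R v - M *v v"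
  define c where "c = \<mu> * (w \<bullet> w) - w \<bullet> (M *v w)"
  define a where "a = w \<bullet> w"
  assume "M *v v \<noteq> \<mu> *\<^sub>R v"
  then have a: "a > 0" by (auto simp: a_def w_def)
  have c: "c \<ge> 0" using bound[of w] by (simp add: c_def)
  have wN: "\<mu> * (v \<bullet> w) - w \<bullet> (M *v v) = a"
    by (simp add: a_def w_def inner_diff_left inner_diff_right inner_commute algebra_simps)
  have quad: "0 \<le> 2 * t * a + t\<^sup>2 * c" for t
  proof -
    have "0 \<le> \<mu> * ((v + t *\<^sub>R w) \<bullet> (v + t *\<^sub>R w)) - (v + t *\<^sub>R w) \<bullet> (M *v (v + t *\<^sub>R w))"
      using bound[of "v + t *\<^sub>R w"] by simp
    also have "\<dots> = (\<mu> * (v \<bullet> v) - v \<bullet> (M *v v)) + 2 * t * (\<mu> * (v \<bullet> w) - w \<bullet> (M *v v)) + t\<^sup>2 * c"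
      using symmetric_matrix_inner[OF sym, of v w]
      by (simp add: c_def matrix_vector_right_distrib inner_add_left inner_add_right
          matrix_vector_mult_scaleR inner_commute[of w v] algebra_simps power2_eq_square)
    finally show ?thesis by (simp add: attained wN)
  qed
  \<comment> \<open>At t = -x the quadratic equals -(x a) - x x < 0; the summand 1 keeps the
    denominator positive when c = 0.\<close>
  define x where "x = a / (c + 1)"
  have x: "x > 0" "x * c = a - x" using a c by (auto simp: x_def field_simps)
  have "0 \<le> 2 * (- x) * a + (- x)\<^sup>2 * c" by (rule quad)
  also have "\<dots> = - (x * a) - x * x"
    using x(2) by (simp add: power2_eq_square mult.assoc right_diff_distrib)
  also have "\<dots> < 0" using mult_pos_pos[OF x(1) a] mult_pos_pos[OF x(1) x(1)] by linarith
  finally show False by simp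
qed

text \<open>By symmetry \<open>M\<close> maps the orthogonal complement of the eigenvector
  \<open>v\<close> into itself, so splitting \<open>z\<close> along \<open>v\<close> leaves no cross
  term in the quadratic form.\<close>

lemma rayleigh_eigenvector_split:
  fixes M :: "real ^ 'm ^ 'm"
  assumes sym: "symmetric_matrix M" and v: "norm v = 1" "M *v v = \<mu> *\<^sub>R v"
  obtains w where "w \<bullet> v = 0" "z \<bullet> (M *v z) = (z \<bullet> v)\<^sup>2 * \<mu> + w \<bullet> (M *v w)"
    "z \<bullet> z = (z \<bullet> v)\<^sup>2 + w \<bullet> w"
proof -
  have vv: "v \<bullet> v = 1" using v by (simp add: norm_eq_1)
  define a where "a = z \<bullet> v"
  define w where "w = z - a *\<^sub>R v"
  have z: "z = a *\<^sub>R v + w" by (simp add: w_def)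
  have wv: "w \<bullet> v = 0" by (simp add: w_def a_def inner_diff_left vv)
  have "v \<bullet> (M *v w) = 0"
    using symmetric_matrix_inner[OF sym, of v w] wv v(2) by simp
  then have "z \<bullet> (M *v z) = a\<^sup>2 * \<mu> + w \<bullet> (M *v w)"
    using wv by (simp add: z matrix_vector_right_distrib matrix_vector_mult_scaleR v(2)
        inner_add_left inner_add_right vv inner_commute[of v w] power2_eq_square)
  moreover have "z \<bullet> z = a\<^sup>2 + w \<bullet> w"
    using wv by (simp add: z inner_add_left inner_add_right vv inner_commute[of v w] power2_eq_square)
  ultimately show ?thesis using that wv unfolding a_def by blast
qed

lemma rayleigh_le_if_normalized_le:
  fixes M :: "real ^ 'm ^ 'm"
  assumes "w \<noteq> 0 \<Longrightarrow> (w /\<^sub>R norm w) \<bullet> (M *v (w /\<^sub>R norm w)) \<le> c"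
  shows "w \<bullet> (M *v w) \<le> c * (w \<bullet> w)"
proof (cases "w = 0")
  case False
  with assms have "(w \<bullet> (M *v w)) / (norm w)\<^sup>2 \<le> c"
    by (simp add: matrix_vector_mult_scaleR power2_eq_square divide_simps split: if_splits)
  then show ?thesis using False by (simp add: field_simps power2_norm_eq_inner)
qed simp

text \<open>In an orthonormal basis starting with the eigenvector, the characteristic matrix has a column
  \<open>(t - \<mu>) e\<close>, so the characteristic polynomial splits off that factor.\<close>

lemma char_poly_split_eigenvector:
  fixes M :: "real ^ 'm ^ 'm"
  assumes sym: "symmetric_matrix M" and v: "norm v = 1" "M *v v = \<mu> *\<^sub>R v"
  obtains q where "char_poly M = [:- \<mu>, 1:] * q"
    "poly q \<mu> = 0 \<longleftrightarrow> (\<exists>w. w \<noteq> 0 \<and> w \<bullet> v = 0 \<and> M *v w = \<mu> *\<^sub>R w)"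
proof -
  note transpose_matrix_vector [simp del]
  \<comment> \<open>Fixes an arbitrary index, which exists because types are nonempty.\<close>
  obtain k :: 'm where True by simp
  obtain Q where Q: "orthogonal_matrix Q" "Q *v axis k 1 = v"
    using orthogonal_matrix_exists_basis[OF v(1), of k] by blast
  have QQ: "transpose Q ** Q = mat 1" "Q ** transpose Q = mat 1"
    using Q(1) by (auto simp: orthogonal_matrix_def)
  define K where "K = transpose Q ** M ** Q"
  have detQ: "det (transpose Q) * det Q = 1"
    by (metis QQ(1) det_I det_mul)
  have tv: "transpose Q *v v = axis k 1"
    by (metis Q(2) QQ(1) matrix_vector_mul_assoc matrix_vector_mul_lid)
  have Kk: "K *v axis k 1 = \<mu> *\<^sub>R axis k 1"
    by (simp add: K_def matrix_vector_mul_assoc[symmetric] Q(2) v(2) tv matrix_vector_mult_scaleR)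
  have symK: "symmetric_matrix K"
    using sym by (simp add: K_def symmetric_matrix_def matrix_transpose_mul matrix_mul_assoc)
  have Kcol: "K $ i $ k = (if i = k then \<mu> else 0)" for i
  proof -
    have "column k K = \<mu> *\<^sub>R axis k 1" using Kk by (simp add: matrix_vector_mult_basis)
    from arg_cong[OF this, of "\<lambda>u. u $ i"] show ?thesis by (simp add: column_def axis_def)
  qed
  have Krow: "K $ k $ i = (if i = k then \<mu> else 0)" for i
  proof -
    have "transpose K $ i $ k = K $ i $ k" using symK by (simp add: symmetric_matrix_def)
    then show ?thesis by (simp add: transpose_def Kcol)
  qed
  \<comment> \<open>\<open>N t\<close> is the characteristic matrix of \<open>K\<close> with the
    factor t - \<mu> taken out of column \<open>k\<close>; \<open>q\<close> is the same determinant
    over polynomials.\<close>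
  define N where "N = (\<lambda>t. \<chi> i j. if j = k then (if i = k then 1 else 0)
      else (t *\<^sub>R mat 1 - K) $ i $ j)"
  define q where "q = det (\<chi> i j. if j = k then (if i = k then 1 else 0)
      else (if i = j then [:0, 1:] else 0) - [:K $ i $ j:])"
  have polyq: "poly q t = det (N t)" for t
  proof -
    have "poly (of_int (sign p)) t = (of_int (sign p) :: real)" for p :: "'m \<Rightarrow> 'm"
      by (simp add: sign_def)
    then show ?thesis
      unfolding q_def N_def det_def
      by (simp add: poly_sum poly_prod) (auto simp: mat_def intro!: sum.cong prod.cong)
  qed
  have detN: "det (t *\<^sub>R mat 1 - K) = (t - \<mu>) * det (N t)" for t
  proof -
    have "transpose (t *\<^sub>R mat 1 - K)
        = (\<chi> i. if i = k then (t - \<mu>) *s transpose (N t) $ k else transpose (N t) $ i)"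
      by (auto simp: vec_eq_iff N_def transpose_def Kcol mat_def)
    moreover have "(\<chi> i. if i = k then transpose (N t) $ k else transpose (N t) $ i) = transpose (N t)"
      by (auto simp: vec_eq_iff)
    ultimately have "det (transpose (t *\<^sub>R mat 1 - K)) = (t - \<mu>) * det (transpose (N t))"
      by (simp only: det_row_mul)
    then show ?thesis by (simp only: det_transpose)
  qed
  have "poly (char_poly M) t = poly ([:- \<mu>, 1:] * q) t" for t
  proof -
    have "t *\<^sub>R mat 1 - K = transpose Q ** (t *\<^sub>R mat 1 - M) ** Q"
    proof -
      have "transpose Q *v (Q *v x) = x" for x
        by (metis QQ(1) matrix_vector_mul_assoc matrix_vector_mul_lid)
      then show ?thesis
        unfolding matrix_eq K_def
        by (simp add: matrix_vector_mul_assoc[symmetric] matrix_vector_mult_diff_rdistrib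
            matrix_vector_mult_diff_distrib scaleR_matrix_vector_assoc[symmetric]
            matrix_vector_mult_scaleR)
    qed
    then have "det (t *\<^sub>R mat 1 - K) = det (transpose Q) * det (t *\<^sub>R mat 1 - M) * det Q"
      by (simp only: det_mul)
    also have "\<dots> = (det (transpose Q) * det Q) * det (t *\<^sub>R mat 1 - M)"
      by (simp only: mult_ac)
    finally have "det (t *\<^sub>R mat 1 - K) = det (t *\<^sub>R mat 1 - M)" by (simp only: detQ mult_1)
    then show ?thesis by (simp add: poly_char_poly detN polyq algebra_simps)
  qed
  then have "char_poly M = [:- \<mu>, 1:] * q" by (intro poly_eqI_degree poly_ext) auto
  moreover have "poly q \<mu> = 0 \<longleftrightarrow> (\<exists>w. w \<noteq> 0 \<and> w \<bullet> v = 0 \<and> M *v w = \<mu> *\<^sub>R w)"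
  proof -
    have Nmult: "N \<mu> *v w = (\<mu> *\<^sub>R w - K *v w) + (w $ k) *\<^sub>R axis k 1" for w
    proof -
      have "N \<mu> = (\<mu> *\<^sub>R mat 1 - K) + (\<chi> i j. if i = k \<and> j = k then 1 else 0)"
        by (auto simp: vec_eq_iff N_def mat_def Kcol)
      moreover have "(\<chi> i j. if i = k \<and> j = k then 1 else 0) *v w = (w $ k) *\<^sub>R axis k 1"
        by (auto simp: vec_eq_iff matrix_vector_mult_def axis_def if_distrib[of "\<lambda>x. x * _"] 
            sum.delta cong: if_cong)
      ultimately show ?thesis
        by (simp add: matrix_vector_mult_add_rdistrib matrix_vector_mult_diff_rdistrib
            scaleR_matrix_vector_assoc[symmetric])
    qed
    have rowk: "(K *v w) $ k = \<mu> * w $ k" for w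
      by (simp add: matrix_vector_mult_def Krow if_distrib[of "\<lambda>x. x * _"] cong: if_cong)
    \<comment> \<open>Row \<open>k\<close> of \<open>N \<mu> *v w\<close> is just
      \<open>w $ k\<close>, because row \<open>k\<close> of \<open>K\<close> is \<mu> times a unit
      vector. Kernel vectors are therefore the \<mu>-eigenvectors of \<open>K\<close> orthogonal to
      \<open>axis k 1\<close>, and \<open>Q\<close> carries these to eigenvectors of
      \<open>M\<close> orthogonal to \<open>v\<close>.\<close>
    have ker: "N \<mu> *v w = 0 \<longleftrightarrow> w $ k = 0 \<and> K *v w = \<mu> *\<^sub>R w" for w
    proof
      assume *: "N \<mu> *v w = 0"
      have "(N \<mu> *v w) $ k = w $ k" by (simp add: Nmult rowk axis_def)
      with * have "w $ k = 0" by simp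
      with * show "w $ k = 0 \<and> K *v w = \<mu> *\<^sub>R w" by (simp add: Nmult)
    qed (simp add: Nmult)
    have trans: "K *v (transpose Q *v w) = transpose Q *v (M *v w)" for w
    proof -
      have "Q *v (transpose Q *v w) = w"
        by (metis QQ(2) matrix_vector_mul_assoc matrix_vector_mul_lid)
      then show ?thesis
        by (simp add: K_def matrix_vector_mul_assoc[symmetric])
    qed
    have Qinj: "transpose Q *v a = transpose Q *v b \<longleftrightarrow> a = b" for a b
      by (metis QQ(2) matrix_vector_mul_assoc matrix_vector_mul_lid)
    have comp: "(transpose Q *v w) $ k = w \<bullet> v" for w
      by (metis Q(2) cart_eq_inner_axis dot_lmul_matrix vector_transpose_matrix transpose_transpose)
    have kerM: "K *v (transpose Q *v w) = \<mu> *\<^sub>R (transpose Q *v w) \<longleftrightarrow> M *v w = \<mu> *\<^sub>R w" for w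
      by (simp add: trans matrix_vector_mult_scaleR[symmetric] Qinj)
    have "poly q \<mu> = 0 \<longleftrightarrow> (\<exists>w. w \<noteq> 0 \<and> N \<mu> *v w = 0)"
      by (simp add: polyq det_eq_0_iff_kernel)
    also have "\<dots> \<longleftrightarrow> (\<exists>w. w \<noteq> 0 \<and> N \<mu> *v (transpose Q *v w) = 0)"
    proof -
      have "u = transpose Q *v (Q *v u)" for u
        by (metis QQ(1) matrix_vector_mul_assoc matrix_vector_mul_lid)
      moreover have "transpose Q *v w = 0 \<longleftrightarrow> w = 0" for w using Qinj[of w 0] by simp
      ultimately show ?thesis by metis
    qed
    finally show ?thesis by (simp add: ker comp kerM)
  qed
  ultimately show ?thesis by (rule that)
qed

section \<open>Simplicity of the leading eigenvalue versus a spectral gap\<close>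

text \<open>A maximizer \<open>v\<close> of the Rayleigh quotient is an eigenvector for \<mu>.
  Multiplicity one makes the cofactor \<open>q\<close> nonzero at \<mu>, so no \<mu>-eigenvector is
  orthogonal to \<open>v\<close>, and compactness of the unit sphere in the complement of
  \<open>v\<close> turns this into a uniform gap.\<close>

lemma leading_simple_eigenvalue_imp_gap:
  fixes M :: "real ^ 'm ^ 'm"
  assumes sym: "symmetric_matrix M" and v: "norm v = 1"
    and max: "\<And>u. norm u = 1 \<Longrightarrow> u \<bullet> (M *v u) \<le> v \<bullet> (M *v v)"
    and lead: "leading_eigenvalue M \<mu>" and simple: "simple_eigenvalue M \<mu>"
  obtains \<gamma> where "\<gamma> > 0" "M *v v = \<mu> *\<^sub>R v"
    "\<And>z. z \<bullet> (M *v z) \<le> \<mu> * (z \<bullet> z) - \<gamma> * (z \<bullet> z - (z \<bullet> v)\<^sup>2)"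
proof -
  define l where "l = v \<bullet> (M *v v)"
  have vv: "v \<bullet> v = 1" using v by (simp add: norm_eq_1)
  have bound: "u \<bullet> (M *v u) \<le> l * (u \<bullet> u)" for u
    unfolding l_def by (intro rayleigh_le_if_normalized_le max) simp
  have Mv: "M *v v = l *\<^sub>R v"
    by (rule rayleigh_max_eigenvector[OF sym bound]) (simp add: l_def vv)
  have "eigenvalue M l" unfolding eigenvalue_def using Mv v by (intro exI[of _ v]) auto
  then have "l \<le> \<mu>" using lead by (auto simp: leading_eigenvalue_def)
  moreover obtain u where u: "u \<noteq> 0" "M *v u = \<mu> *\<^sub>R u"
    using lead by (auto simp: leading_eigenvalue_def eigenvalue_def)
  moreover have "\<mu> \<le> l" using bound[of u] u by simp
  ultimately have l: "l = \<mu>" by simp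
  obtain q where q: "char_poly M = [:- \<mu>, 1:] * q"
    "poly q \<mu> = 0 \<longleftrightarrow> (\<exists>w. w \<noteq> 0 \<and> w \<bullet> v = 0 \<and> M *v w = \<mu> *\<^sub>R w)"
    using char_poly_split_eigenvector[OF sym v] Mv l by metis
  \<comment> \<open>A point that is not a root shows that the characteristic polynomial is nonzero,
    so \<open>order\<close> does measure multiplicity.\<close>
  have "\<not> eigenvalue M (\<mu> + 1)" using lead by (force simp: leading_eigenvalue_def)
  then have nz: "char_poly M \<noteq> 0"
    by (metis eigenvalue_iff_det poly_0 poly_char_poly)
  have "poly q \<mu> \<noteq> 0"
  proof
    assume "poly q \<mu> = 0"
    then have "[:- \<mu>, 1:] ^ 2 dvd char_poly M"
      unfolding q(1) power2_eq_square by (intro mult_dvd_mono) (auto simp: poly_eq_0_iff_dvd)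
    then have "2 \<le> order \<mu> (char_poly M)" using nz by (simp add: order_divides)
    then show False using simple by (simp add: simple_eigenvalue_def)
  qed
  then have nev: "M *v w \<noteq> \<mu> *\<^sub>R w" if "w \<noteq> 0" "w \<bullet> v = 0" for w
    using q(2) that by blast
  define W where "W = {w. norm w = 1 \<and> w \<bullet> v = 0}"
  have "\<exists>\<gamma>>0. \<forall>w\<in>W. w \<bullet> (M *v w) \<le> \<mu> - \<gamma>"
  \<comment> \<open>In dimension one \<open>W\<close> is empty and any positive gap serves.\<close>
  proof (cases "W = {}")
    case False
    have "W = sphere 0 1 \<inter> {w. w \<bullet> v = 0}" by (auto simp: W_def)
    moreover have "closed {w. w \<bullet> v = 0}"
      by (intro closed_Collect_eq continuous_intros)
    ultimately have "compact W" by (simp add: compact_Int_closed)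
    moreover have "continuous_on W (\<lambda>w. w \<bullet> (M *v w))"
      by (intro continuous_intros matrix_vector_mult_linear_continuous_on)
    ultimately obtain w where w: "w \<in> W" "\<forall>u\<in>W. u \<bullet> (M *v u) \<le> w \<bullet> (M *v w)"
      using continuous_attains_sup[of W] False by blast
    have "w \<bullet> (M *v w) \<noteq> \<mu>"
    proof
      assume "w \<bullet> (M *v w) = \<mu>"
      then have "M *v w = \<mu> *\<^sub>R w"
        using w(1) bound by (intro rayleigh_max_eigenvector[OF sym]) (auto simp: l W_def norm_eq_1)
      moreover have "w \<noteq> 0" using w(1) by (auto simp: W_def)
      ultimately show False using nev[of w] w(1) by (simp add: W_def)
    qed
    moreover have "w \<bullet> (M *v w) \<le> \<mu>" using bound[of w] w(1) by (auto simp: l W_def norm_eq_1)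
    ultimately have "\<mu> - w \<bullet> (M *v w) > 0" by simp
    then show ?thesis using w(2) by (intro exI[of _ "\<mu> - w \<bullet> (M *v w)"]) auto
  qed (auto intro: exI[of _ 1])
  then obtain \<gamma> where \<gamma>: "\<gamma> > 0" "\<And>w. w \<in> W \<Longrightarrow> w \<bullet> (M *v w) \<le> \<mu> - \<gamma>" by blast
  have perp: "w \<bullet> (M *v w) \<le> (\<mu> - \<gamma>) * (w \<bullet> w)" if "w \<bullet> v = 0" for w
    by (intro rayleigh_le_if_normalized_le \<gamma>(2)) (simp add: W_def that)
  have "z \<bullet> (M *v z) \<le> \<mu> * (z \<bullet> z) - \<gamma> * (z \<bullet> z - (z \<bullet> v)\<^sup>2)" for z
  proof -
    obtain w where w: "w \<bullet> v = 0" "z \<bullet> (M *v z) = (z \<bullet> v)\<^sup>2 * \<mu> + w \<bullet> (M *v w)"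
      "z \<bullet> z = (z \<bullet> v)\<^sup>2 + w \<bullet> w"
      using rayleigh_eigenvector_split[OF sym v, of \<mu> z] Mv l by metis
    show ?thesis using perp[OF w(1)] unfolding w(2,3) by (simp add: algebra_simps)
  qed
  then show ?thesis using that \<gamma>(1) Mv l by blast
qed

text \<open>The converse direction: a strict bound on the complement of \<open>v\<close> excludes a
  further \<mu>-eigenvector there, so the cofactor \<open>q\<close> does not vanish at \<mu>. The
  Rayleigh bound is recorded because it later yields optimality over the feasible set.\<close>

lemma gap_imp_leading_simple_eigenvalue:
  fixes M :: "real ^ 'm ^ 'm"
  assumes sym: "symmetric_matrix M" and v: "norm v = 1" "M *v v = \<mu> *\<^sub>R v"
    and gap: "\<And>w. w \<noteq> 0 \<Longrightarrow> w \<bullet> v = 0 \<Longrightarrow> w \<bullet> (M *v w) < \<mu> * (w \<bullet> w)"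
  shows "leading_eigenvalue M \<mu>" "simple_eigenvalue M \<mu>"
    "z \<bullet> (M *v z) \<le> \<mu> * (z \<bullet> z)"
proof -
  have bound: "z \<bullet> (M *v z) \<le> \<mu> * (z \<bullet> z)" for z
  proof -
    obtain w where w: "w \<bullet> v = 0" "z \<bullet> (M *v z) = (z \<bullet> v)\<^sup>2 * \<mu> + w \<bullet> (M *v w)"
      "z \<bullet> z = (z \<bullet> v)\<^sup>2 + w \<bullet> w"
      using rayleigh_eigenvector_split[OF sym v, of z] by metis
    have "w \<bullet> (M *v w) \<le> \<mu> * (w \<bullet> w)" using gap[OF _ w(1)] by (cases "w = 0") auto
    then show ?thesis unfolding w(2,3) by (simp add: algebra_simps)
  qed
  then show "z \<bullet> (M *v z) \<le> \<mu> * (z \<bullet> z)" .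
  have ev: "eigenvalue M \<mu>" unfolding eigenvalue_def using v by (intro exI[of _ v]) auto
  have "\<nu> \<le> \<mu>" if "M *v u = \<nu> *\<^sub>R u" "u \<noteq> 0" for u \<nu>
    using bound[of u] that by simp
  then show "leading_eigenvalue M \<mu>" using ev by (auto simp: leading_eigenvalue_def eigenvalue_def)
  obtain q where q: "char_poly M = [:- \<mu>, 1:] * q"
    "poly q \<mu> = 0 \<longleftrightarrow> (\<exists>w. w \<noteq> 0 \<and> w \<bullet> v = 0 \<and> M *v w = \<mu> *\<^sub>R w)"
    using char_poly_split_eigenvector[OF sym v] by metis
  have "poly q \<mu> \<noteq> 0" using q(2) gap by force
  then have "order \<mu> ([:- \<mu>, 1:] * q) = 1"
    using order_power_n_n[of \<mu> 1] by (subst order_mult) (auto simp: order_0I simp del: mult_pCons_left)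
  then show "simple_eigenvalue M \<mu>" using ev q(1) by (simp add: simple_eigenvalue_def)
qed

section \<open>Pure tensors and symmetrization\<close>

text \<open>Pairing \<open>T\<close> with these evaluates \<open>T\<close> as a multilinear form at
  the vectors \<open>y p\<close>; tensor identities below are mostly checked through such
  evaluations.\<close>

definition pure_tensor :: "('d::finite \<Rightarrow> real ^ 'n::finite) \<Rightarrow> ('d, 'n) tensor" where
  "pure_tensor y = (\<chi> i. \<Prod>p\<in>UNIV. y p $ i p)"

definition permute_tensor :: "('d::finite \<Rightarrow> 'd) \<Rightarrow> ('d, 'n::finite) tensor \<Rightarrow> ('d, 'n) tensor" where
  "permute_tensor s T = (\<chi> i. T $ (i \<circ> s))"

lemma sum_prod_indices:
  fixes f :: "'d::finite \<Rightarrow> 'n::finite \<Rightarrow> real"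
  shows "(\<Sum>i\<in>UNIV. \<Prod>p\<in>UNIV. f p (i p)) = (\<Prod>p\<in>UNIV. \<Sum>b\<in>UNIV. f p b)"
  by (subst prod_sum_PiE) auto

lemma inner_pure_tensor: "T \<bullet> pure_tensor y = (\<Sum>i\<in>UNIV. T $ i * (\<Prod>p\<in>UNIV. y p $ i p))"
  by (simp add: inner_vec_def pure_tensor_def)

lemma pure_tensor_inner_pure_tensor:
  "pure_tensor y \<bullet> pure_tensor z = (\<Prod>p\<in>UNIV. y p \<bullet> z p)"
  by (simp add: inner_pure_tensor pure_tensor_def inner_vec_def prod.distrib[symmetric]
      sum_prod_indices[of "\<lambda>p b. y p $ b * z p $ b"])

lemma pure_tensor_axis: "pure_tensor (\<lambda>p. axis (i p) 1) = axis i 1"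
proof -
  have "(\<Prod>p\<in>UNIV. axis (i p) 1 $ j p) = (if j = i then 1 else 0 :: real)" for j
  proof (cases "j = i")
    case False
    then obtain p where "j p \<noteq> i p" by auto
    then have "(\<Prod>p\<in>UNIV. axis (i p) 1 $ j p) = (0::real)"
      by (intro prod_zero) (auto simp: axis_def)
    then show ?thesis using False by simp
  qed (simp add: axis_def)
  then show ?thesis by (simp add: pure_tensor_def vec_eq_iff axis_def)
qed

text \<open>The axis tensors are pure, so the multilinear form determines every entry.\<close>

lemma tensor_eqI:
  assumes "\<And>y. T \<bullet> pure_tensor y = T' \<bullet> pure_tensor y"
  shows "T = T'"
proof -
  have "T $ i = T' $ i" for i
    using assms[of "\<lambda>p. axis (i p) 1"] by (simp add: pure_tensor_axis inner_axis)
  then show ?thesis by (simp add: vec_eq_iff)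
qed

lemma pure_tensor_eq_0: "y p = 0 \<Longrightarrow> pure_tensor y = 0"
  by (auto simp: pure_tensor_def vec_eq_iff intro!: prod_zero exI[of _ p])

lemma pure_tensor_scaleR:
  "pure_tensor (\<lambda>p. c p *\<^sub>R y p) = (\<Prod>p\<in>UNIV. c p) *\<^sub>R pure_tensor y"
  by (simp add: pure_tensor_def vec_eq_iff prod.distrib)

lemma pure_tensor_add:
  "pure_tensor (\<lambda>p. y p + z p) = (\<Sum>S\<in>UNIV. pure_tensor (\<lambda>p. if p \<in> S then y p else z p))"
proof -
  have "(\<Prod>p\<in>UNIV. y p $ i p + z p $ i p)
      = (\<Sum>S\<in>UNIV. \<Prod>p\<in>UNIV. (if p \<in> S then y p else z p) $ i p)" for i
  proof -
    have "(\<Prod>p\<in>S. y p $ i p) * (\<Prod>p\<in>UNIV - S. z p $ i p)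
        = (\<Prod>p\<in>UNIV. (if p \<in> S then y p else z p) $ i p)" for S
      by (subst prod.subset_diff[of S UNIV]) (auto intro!: arg_cong2[of _ _ _ _ "(*)"] prod.cong)
    then show ?thesis by (simp add: prod_add)
  qed
  then show ?thesis by (simp add: pure_tensor_def vec_eq_iff)
qed

lemma permute_tensor_inner_pure:
  assumes "bij s"
  shows "permute_tensor s T \<bullet> pure_tensor y = T \<bullet> pure_tensor (y \<circ> s)"
proof -
  have inv: "i \<circ> s \<circ> inv s = i" "i \<circ> inv s \<circ> s = i" for i :: "'a \<Rightarrow> 'b"
    using assms by (auto simp: fun_eq_iff bij_is_surj surj_f_inv_f bij_is_inj inv_f_f)
  have "(\<Sum>i\<in>UNIV. T $ (i \<circ> s) * (\<Prod>p\<in>UNIV. y p $ i p))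
      = (\<Sum>j\<in>UNIV. T $ j * (\<Prod>p\<in>UNIV. (y \<circ> s) p $ j p))"
  proof (rule sum.reindex_bij_witness[of _ "\<lambda>j. j \<circ> inv s" "\<lambda>i. i \<circ> s"])
    fix i
    show "T $ (i \<circ> s) * (\<Prod>p\<in>UNIV. (y \<circ> s) p $ (i \<circ> s) p) = T $ (i \<circ> s) * (\<Prod>p\<in>UNIV. y p $ i p)"
      using prod.reindex_bij_betw[of s UNIV UNIV "\<lambda>p. y p $ i p"] assms by simp
  qed (auto simp: inv)
  then show ?thesis by (simp add: inner_pure_tensor permute_tensor_def)
qed

lemma tensor_Sym_eq:
  "tensor_Sym T = (1 / fact CARD('d)) *\<^sub>R (\<Sum>s | s permutes UNIV. permute_tensor s T)"
  for T :: "('d::finite, 'n::finite) tensor"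
  by (simp add: tensor_Sym_def permute_tensor_def vec_eq_iff)

lemma tensor_Sym_inner_pure:
  "tensor_Sym T \<bullet> pure_tensor y
    = (\<Sum>s | s permutes UNIV. T \<bullet> pure_tensor (y \<circ> s)) / fact CARD('d)"
  for T :: "('d::finite, 'n::finite) tensor"
  by (simp add: tensor_Sym_eq inner_sum_left permute_tensor_inner_pure permutes_bij)

lemma tensor_Sym_inner_pure_const:
  "tensor_Sym T \<bullet> pure_tensor (\<lambda>_. x) = T \<bullet> pure_tensor (\<lambda>_. x)"
  for T :: "('d::finite, 'n::finite) tensor"
  by (simp add: tensor_Sym_inner_pure comp_def card_permutations[OF refl])

lemma permute_tensor_linear: "linear (permute_tensor s)"
  by (intro linearI) (auto simp: permute_tensor_def vec_eq_iff)

lemma tensor_Sym_linear: "linear (tensor_Sym :: ('d::finite, 'n::finite) tensor \<Rightarrow> _)"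
  unfolding tensor_Sym_eq[abs_def]
  by (intro linear_compose_scale_right linear_compose_sum ballI permute_tensor_linear)

lemma tensor_Sym_permute:
  fixes T :: "('d::finite, 'n::finite) tensor"
  assumes "s permutes UNIV"
  shows "tensor_Sym (permute_tensor s T) = tensor_Sym T"
proof -
  have "(\<Sum>t | t permutes UNIV. permute_tensor t (permute_tensor s T))
      = (\<Sum>t | t permutes UNIV. permute_tensor (t \<circ> s) T)"
    by (simp add: permute_tensor_def comp_assoc)
  also have "\<dots> = (\<Sum>t | t permutes UNIV. permute_tensor t T)"
    using sum_permutations_compose_right[OF assms, of "\<lambda>t. permute_tensor t T"] by simp
  finally show ?thesis by (simp add: tensor_Sym_eq)
qed

lemma permute_symmetric_tensor:
  "A \<in> symmetric_tensors \<Longrightarrow> s permutes UNIV \<Longrightarrow> permute_tensor s A = A"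
  by (simp add: symmetric_tensors_def permute_tensor_def vec_eq_iff)

lemma tensor_Sym_symmetric:
  "A \<in> symmetric_tensors \<Longrightarrow> tensor_Sym A = A"
  for A :: "('d::finite, 'n::finite) tensor"
  by (simp add: tensor_Sym_eq permute_symmetric_tensor card_permutations[OF refl]
      sum_constant_scaleR del: sum_constant)

lemma pure_tensor_const_symmetric: "pure_tensor (\<lambda>_::'d::finite. x) \<in> symmetric_tensors"
proof -
  have "(\<Prod>p\<in>UNIV. x $ i (s p)) = (\<Prod>p\<in>UNIV. x $ i p)"
    if "s permutes UNIV" for s :: "'d \<Rightarrow> 'd" and i
    using prod.permute[OF that, of "\<lambda>p. x $ i p"] by (simp add: comp_def)
  then show ?thesis by (simp add: symmetric_tensors_def pure_tensor_def)
qed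

section \<open>Splitting a tensor along a vector and its complement\<close>

definition split_vec :: "real ^ 'n \<Rightarrow> 'd set \<Rightarrow> 'd \<Rightarrow> real ^ 'n \<Rightarrow> real ^ 'n" where
  "split_vec x S p y = (if p \<in> S then y - (x \<bullet> y) *\<^sub>R x else (x \<bullet> y) *\<^sub>R x)"

text \<open>The tensor product of the projections \<open>I - x x\<^sup>T\<close> at the positions in \<open>S\<close>
  and \<open>x x\<^sup>T\<close> at the remaining ones, for a unit vector \<open>x\<close>.\<close>

definition split_tensor ::
    "real ^ 'n \<Rightarrow> 'd set \<Rightarrow> ('d::finite, 'n::finite) tensor \<Rightarrow> ('d, 'n) tensor" where
  "split_tensor x S T = (\<chi> i. T \<bullet> pure_tensor (\<lambda>p. split_vec x S p (axis (i p) 1)))"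

lemma split_vec_linear: "linear (split_vec x S p)"
  by (intro linearI) (auto simp: split_vec_def inner_add_right algebra_simps)

lemma linear_axis_expansion:
  fixes f :: "real ^ 'n \<Rightarrow> real ^ 'n"
  assumes "linear f"
  shows "f y $ j = (\<Sum>b\<in>UNIV. y $ b * f (axis b 1) $ j)"
proof -
  have "f y = f (\<Sum>b\<in>UNIV. y $ b *\<^sub>R axis b 1)"
    by (simp add: basis_expansion scalar_mult_eq_scaleR[symmetric])
  also have "\<dots> = (\<Sum>b\<in>UNIV. y $ b *\<^sub>R f (axis b 1))"
    using assms by (simp add: linear_sum linear_scale)
  finally show ?thesis by simp
qed

text \<open>At axis vectors this is the definition of \<open>split_tensor\<close>; both sides are
  multilinear in \<open>y\<close>.\<close>

lemma split_tensor_inner_pure: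
  "split_tensor x S T \<bullet> pure_tensor y = T \<bullet> pure_tensor (\<lambda>p. split_vec x S p (y p))"
proof -
  have "(\<Sum>i\<in>UNIV. (\<Prod>p\<in>UNIV. y p $ i p) *\<^sub>R
        pure_tensor (\<lambda>p. split_vec x S p (axis (i p) 1))) $ j
      = pure_tensor (\<lambda>p. split_vec x S p (y p)) $ j" (is "?lhs = ?rhs") for j
  proof -
    have "?lhs = (\<Prod>p\<in>UNIV. \<Sum>b\<in>UNIV. y p $ b * split_vec x S p (axis b 1) $ j p)"
      by (simp add: pure_tensor_def prod.distrib[symmetric]
          sum_prod_indices[of "\<lambda>p b. y p $ b * split_vec x S p (axis b 1) $ j p"])
    also have "\<dots> = ?rhs"
      by (simp add: pure_tensor_def linear_axis_expansion[OF split_vec_linear, symmetric])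
    finally show ?thesis .
  qed
  then have "(\<Sum>i\<in>UNIV. (\<Prod>p\<in>UNIV. y p $ i p) *\<^sub>R
        pure_tensor (\<lambda>p. split_vec x S p (axis (i p) 1)))
      = pure_tensor (\<lambda>p. split_vec x S p (y p))" by (simp only: vec_eq_iff simp_thms)
  from this[symmetric] show ?thesis
    unfolding inner_pure_tensor[of "split_tensor x S T"]
    by (simp add: inner_sum_right split_tensor_def mult.commute)
qed

text \<open>At each position the two parts of a vector add up to the vector itself; multiplying out
  over all positions gives one term per set \<open>S\<close>.\<close>

lemma sum_split_tensor:
  fixes T :: "('d::finite, 'n::finite) tensor"
  shows "(\<Sum>S\<in>UNIV. split_tensor x S T) = T"
proof (rule tensor_eqI)
  fix y :: "'d \<Rightarrow> real ^ 'n"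
  have "pure_tensor y = pure_tensor (\<lambda>p. (y p - (x \<bullet> y p) *\<^sub>R x) + (x \<bullet> y p) *\<^sub>R x)" by simp
  also have "\<dots> = (\<Sum>S\<in>UNIV. pure_tensor (\<lambda>p. split_vec x S p (y p)))"
    unfolding pure_tensor_add split_vec_def ..
  finally have "T \<bullet> pure_tensor y = (\<Sum>S\<in>UNIV. T \<bullet> pure_tensor (\<lambda>p. split_vec x S p (y p)))"
    by (simp only: inner_sum_right)
  then show "(\<Sum>S\<in>UNIV. split_tensor x S T) \<bullet> pure_tensor y = T \<bullet> pure_tensor y"
    by (simp only: inner_sum_left split_tensor_inner_pure)
qed

lemma sum_card_1: "(\<Sum>S | card S = 1. f S) = (\<Sum>p\<in>UNIV. f {p})"
  for f :: "'d::finite set \<Rightarrow> 'c::comm_monoid_add"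
proof -
  have "{S::'d set. card S = 1} = (\<lambda>p. {p}) ` UNIV" by (auto simp: card_1_singleton_iff)
  then show ?thesis by (simp add: sum.reindex)
qed

text \<open>Permuting positions permutes the singleton components among themselves, so symmetrizing
  their sum amounts to splitting the symmetrized tensor. Each resulting term has \<open>x\<close> at
  all positions but one and a vector orthogonal to \<open>x\<close> there, and vanishes by
  \<open>crit\<close>.\<close>

lemma tensor_Sym_split_singletons:
  fixes T :: "('d::finite, 'n::finite) tensor"
  assumes crit: "\<And>p z. x \<bullet> z = 0 \<Longrightarrow> tensor_Sym T \<bullet> pure_tensor ((\<lambda>_. x)(p := z)) = 0"
    and x: "x \<bullet> x = 1"
  shows "tensor_Sym (\<Sum>p\<in>UNIV. split_tensor x {p} T) = 0"
proof (rule tensor_eqI)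
  fix y :: "'d \<Rightarrow> real ^ 'n"
  define G where "G = (\<lambda>(z :: 'd \<Rightarrow> real ^ 'n) (p :: 'd). pure_tensor (\<lambda>q. split_vec x {p} q (z q)))"
  have zero: "tensor_Sym T \<bullet> G y p = 0" for p
  proof -
    have "G y p = pure_tensor (\<lambda>q. (if q = p then 1 else x \<bullet> y q) *\<^sub>R
        ((\<lambda>_. x)(p := y p - (x \<bullet> y p) *\<^sub>R x)) q)"
      unfolding G_def by (intro arg_cong[of _ _ pure_tensor]) (auto simp: split_vec_def)
    moreover have "tensor_Sym T \<bullet> pure_tensor ((\<lambda>_. x)(p := y p - (x \<bullet> y p) *\<^sub>R x)) = 0"
      by (rule crit) (simp add: inner_diff_right x)
    ultimately show ?thesis by (simp only: pure_tensor_scaleR inner_scaleR_right mult_zero_right)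
  qed
  have comp: "(\<lambda>q. split_vec x {p} q (y q)) \<circ> s = (\<lambda>q. split_vec x {inv s p} q ((y \<circ> s) q))"
    if "s permutes UNIV" for s p
  proof -
    have "s q \<in> {p} \<longleftrightarrow> q \<in> {inv s p}" for q using permutes_inv_eq[OF that, of p q] by auto
    then show ?thesis by (simp only: split_vec_def fun_eq_iff comp_apply simp_thms)
  qed
  have "tensor_Sym (\<Sum>p\<in>UNIV. split_tensor x {p} T) \<bullet> pure_tensor y
      = (\<Sum>s | s permutes UNIV. \<Sum>p\<in>UNIV. T \<bullet> G (y \<circ> s) p) / fact CARD('d)"
    by (simp add: tensor_Sym_inner_pure inner_sum_left split_tensor_inner_pure G_def)
  \<comment> \<open>For each \<open>s\<close>, position \<open>p\<close> is renamed to
    \<open>inv s p\<close>: splitting \<open>y \<circ> s\<close> there is the same as splitting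
    \<open>y\<close> at \<open>p\<close> and then permuting, which reassembles
    \<open>tensor_Sym T\<close>.\<close>
  also have "(\<Sum>s | s permutes UNIV. \<Sum>p\<in>UNIV. T \<bullet> G (y \<circ> s) p)
      = (\<Sum>s | s permutes UNIV. \<Sum>p\<in>UNIV. T \<bullet> G (y \<circ> s) (inv s p))"
  proof (rule sum.cong[OF refl])
    fix s :: "'d \<Rightarrow> 'd" assume "s \<in> {s. s permutes UNIV}"
    then have "bij (inv s)" by (auto intro: permutes_bij permutes_inv)
    then show "(\<Sum>p\<in>UNIV. T \<bullet> G (y \<circ> s) p) = (\<Sum>p\<in>UNIV. T \<bullet> G (y \<circ> s) (inv s p))"
      using sum.reindex_bij_betw[of "inv s" UNIV UNIV "\<lambda>p. T \<bullet> G (y \<circ> s) p"] by simp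
  qed
  also have "\<dots> / fact CARD('d) = (\<Sum>p\<in>UNIV. tensor_Sym T \<bullet> G y p)"
    unfolding G_def tensor_Sym_inner_pure sum_divide_distrib
    by (subst sum.swap) (auto intro!: sum.cong simp: comp)
  finally show "tensor_Sym (\<Sum>p\<in>UNIV. split_tensor x {p} T) \<bullet> pure_tensor y = 0 \<bullet> pure_tensor y"
    by (simp add: zero)
qed

section \<open>Moving orthogonal indices across the two halves\<close>

text \<open>\<open>S\<close> stands for the positions carrying directions orthogonal to
  \<open>x\<close>. If it meets both halves, the component vanishes as soon as either half is filled
  with copies of \<open>x\<close>.\<close>

definition straddles :: "('k + 'k) set \<Rightarrow> bool" where
  "straddles S \<longleftrightarrow> (\<exists>a b. Inl a \<in> S \<and> Inr b \<in> S)"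

text \<open>The identity is prescribed on sets that need no repair, so that an existing certificate
  is left unchanged. A singleton can never be made to straddle, and the choice is arbitrary
  there.\<close>

definition spread :: "('k + 'k) set \<Rightarrow> 'k + 'k \<Rightarrow> 'k + 'k" where
  "spread S = (if S = {} \<or> straddles S then id
     else (SOME s. s permutes UNIV \<and> straddles (s ` S)))"

text \<open>A nonempty set that neither straddles nor is a singleton has two positions in one half.
  Exchanging one of them with its counterpart in the other half leaves the second in place, so both
  halves are met.\<close>

lemma spread:
  fixes S :: "('k::finite + 'k) set"
  assumes "card S \<noteq> 1"
  shows "spread S permutes UNIV" "S \<noteq> {} \<Longrightarrow> straddles (spread S ` S)"
proof -
  have "spread S permutes UNIV \<and> straddles (spread S ` S)" if S: "S \<noteq> {}" "\<not> straddles S"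
  proof -
    obtain p p' where p: "p \<in> S" "p' \<in> S" "p \<noteq> p'"
      using S(1) assms by (metis card_1_singleton_iff One_nat_def is_singletonI' is_singleton_def)
    have "\<exists>s. s permutes UNIV \<and> straddles (s ` S)"
    proof (cases p)
      case (Inl a)
      then obtain a' where a': "p' = Inl a'" using S(2) p by (cases p') (auto simp: straddles_def)
      let ?s = "Transposition.transpose (Inl a) (Inr a)"
      have "Inr a = ?s p" "Inl a' = ?s p'" using Inl a' p by (auto simp: Transposition.transpose_def)
      then have "straddles (?s ` S)" using p unfolding straddles_def by blast
      then show ?thesis using permutes_swap_id[of "Inl a" UNIV "Inr a"] by auto
    next
      case (Inr a)
      then obtain a' where a': "p' = Inr a'" using S(2) p by (cases p') (auto simp: straddles_def)
      let ?s = "Transposition.transpose (Inl a) (Inr a)"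
      have "Inl a = ?s p" "Inr a' = ?s p'" using Inr a' p by (auto simp: Transposition.transpose_def)
      then have "straddles (?s ` S)" using p unfolding straddles_def by blast
      then show ?thesis using permutes_swap_id[of "Inl a" UNIV "Inr a"] by auto
    qed
    from someI_ex[OF this] show ?thesis using S by (simp add: spread_def)
  qed
  then show "spread S permutes UNIV" "S \<noteq> {} \<Longrightarrow> straddles (spread S ` S)"
    by (auto simp: spread_def permutes_id)
qed

text \<open>Moving a non-\<open>x\<close> index of each component to the other half of the positions makes
  \<open>x \<otimes> \<dots> \<otimes> x\<close> an eigenvector of the reshaping, while permutations of positions are invisible
  to \<^const>\<open>tensor_Sym\<close>. The components with a single such index cannot be treated in this way
  and are dropped; at a critical point \<open>x\<close> of the symmetrized tensor they contribute nothing.\<close>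

definition rebalance ::
    "real ^ 'n \<Rightarrow> ('k::finite + 'k, 'n::finite) tensor \<Rightarrow> ('k + 'k, 'n) tensor" where
  "rebalance x T = (\<Sum>S | card S \<noteq> 1. permute_tensor (spread S) (split_tensor x S T))"

text \<open>With one half of \<open>y\<close> constantly \<open>x\<close>, every nonempty straddling
  image has a position where \<open>x\<close> is projected onto its own complement, giving 0. Only
  the component of the empty set survives.\<close>

lemma rebalance_inner_pure:
  fixes T :: "('k::finite + 'k, 'n::finite) tensor"
  assumes x: "x \<bullet> x = 1" and y: "(\<forall>q. y (Inl q) = x) \<or> (\<forall>q. y (Inr q) = x)"
  shows "rebalance x T \<bullet> pure_tensor y = (\<Prod>p\<in>UNIV. x \<bullet> y p) * (T \<bullet> pure_tensor (\<lambda>_. x))"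
proof -
  define h where "h = (\<lambda>S. permute_tensor (spread S) (split_tensor x S T) \<bullet> pure_tensor y)"
  have h: "h S = T \<bullet> pure_tensor (\<lambda>p. split_vec x S p (y (spread S p)))" if "card S \<noteq> 1" for S
    using spread(1)[OF that]
    by (simp add: h_def permute_tensor_inner_pure permutes_bij split_tensor_inner_pure)
  have h0: "h S = 0" if S: "card S \<noteq> 1" "S \<noteq> {}" for S
  proof -
    obtain p where "p \<in> S" "y (spread S p) = x"
      using spread(2)[OF S] y by (auto simp: straddles_def image_iff) metis+
    then have "pure_tensor (\<lambda>p. split_vec x S p (y (spread S p))) = 0"
      by (intro pure_tensor_eq_0[of _ p]) (simp add: split_vec_def x)
    then show ?thesis by (simp add: h[OF S(1)])
  qed
  have "rebalance x T \<bullet> pure_tensor y = (\<Sum>S | card S \<noteq> 1. h S)"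
    by (simp add: rebalance_def inner_sum_left h_def)
  also have "\<dots> = h {}"
    using h0 by (subst sum.mono_neutral_right[of _ "{{}}"]) auto
  finally show ?thesis
    by (simp add: h split_vec_def spread_def pure_tensor_scaleR)
qed

text \<open>The hypothesis says that x \<otimes> ... \<otimes> x is an eigenvector of the reshaping
  from both sides. It kills every component with a nonempty set inside one half, singletons
  included; the other components are not moved by \<open>spread\<close>.\<close>

lemma rebalance_fixed:
  fixes T :: "('k::finite + 'k, 'n::finite) tensor"
  assumes x: "x \<bullet> x = 1"
    and T: "\<And>y. (\<forall>q. y (Inl q) = x) \<or> (\<forall>q. y (Inr q) = x) \<Longrightarrow>
      T \<bullet> pure_tensor y = \<mu> * (\<Prod>p\<in>UNIV. x \<bullet> y p)"
  shows "rebalance x T = T"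
proof -
  have zero: "split_tensor x S T = 0" if S: "S \<noteq> {}" "\<not> straddles S" for S
  proof (rule tensor_eqI)
    fix y :: "'k + 'k \<Rightarrow> real ^ 'n"
    \<comment> \<open>Pulling the scalars \<open>x \<bullet> y p\<close> out at positions outside
      \<open>S\<close> leaves exactly \<open>x\<close> throughout one half, so that \<open>T\<close>
      applies.\<close>
    define y' where "y' = (\<lambda>p. if p \<in> S then y p - (x \<bullet> y p) *\<^sub>R x else x)"
    obtain p where p: "p \<in> S" using S by blast
    have "T \<bullet> pure_tensor y' = \<mu> * (\<Prod>p\<in>UNIV. x \<bullet> y' p)"
      using S(2) by (intro T) (auto simp: y'_def straddles_def)
    moreover have "(\<Prod>p\<in>UNIV. x \<bullet> y' p) = 0"
      using p by (intro prod_zero bexI[of _ p]) (auto simp: y'_def inner_diff_right x)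
    moreover have "pure_tensor (\<lambda>p. split_vec x S p (y p))
        = pure_tensor (\<lambda>p. (if p \<in> S then 1 else x \<bullet> y p) *\<^sub>R y' p)"
      by (intro arg_cong[of _ _ pure_tensor]) (auto simp: split_vec_def y'_def)
    ultimately show "split_tensor x S T \<bullet> pure_tensor y = 0 \<bullet> pure_tensor y"
      by (simp add: split_tensor_inner_pure pure_tensor_scaleR)
  qed
  have "rebalance x T = (\<Sum>S | card S \<noteq> 1. split_tensor x S T)"
    unfolding rebalance_def
  proof (rule sum.cong[OF refl])
    fix S :: "('k + 'k) set"
    show "permute_tensor (spread S) (split_tensor x S T) = split_tensor x S T"
    proof (cases "S = {} \<or> straddles S")
      case True
      then show ?thesis by (simp add: spread_def permute_tensor_def)
    next
      case False
      then show ?thesis by (simp add: zero linear_0[OF permute_tensor_linear])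
    qed
  qed
  also have "\<dots> = (\<Sum>S\<in>UNIV. split_tensor x S T)"
    by (intro sum.mono_neutral_left) (auto simp: card_1_singleton_iff straddles_def intro!: zero)
  finally show ?thesis by (simp add: sum_split_tensor)
qed

lemma tensor_Sym_rebalance:
  fixes T :: "('k::finite + 'k, 'n::finite) tensor"
  assumes "\<And>p z. x \<bullet> z = 0 \<Longrightarrow> tensor_Sym T \<bullet> pure_tensor ((\<lambda>_. x)(p := z)) = 0"
    and "x \<bullet> x = 1"
  shows "tensor_Sym (rebalance x T) = tensor_Sym T"
proof -
  have "(\<Sum>S\<in>{S. card S \<noteq> 1} \<union> {S. card S = 1}. split_tensor x S T)
      = (\<Sum>S | card S \<noteq> 1. split_tensor x S T) + (\<Sum>S | card S = 1. split_tensor x S T)"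
    by (rule sum.union_disjoint) auto
  moreover have "{S :: ('k + 'k) set. card S \<noteq> 1} \<union> {S. card S = 1} = UNIV" by auto
  ultimately have "T = (\<Sum>S | card S \<noteq> 1. split_tensor x S T) + (\<Sum>S | card S = 1. split_tensor x S T)"
    by (simp only: sum_split_tensor)
  then have "tensor_Sym T = tensor_Sym (\<Sum>S | card S \<noteq> 1. split_tensor x S T)
      + tensor_Sym (\<Sum>S | card S = 1. split_tensor x S T)"
    by (metis linear_add[OF tensor_Sym_linear])
  also have "tensor_Sym (\<Sum>S | card S = 1. split_tensor x S T) = 0"
    unfolding sum_card_1 by (rule tensor_Sym_split_singletons[OF assms])
  finally show ?thesis
    by (simp add: rebalance_def linear_sum[OF tensor_Sym_linear] tensor_Sym_permute spread)
qed

section \<open>Continuity of the construction\<close>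

lemma tendsto_pure_tensor:
  assumes "\<And>p. ((\<lambda>t. y t p) \<longlongrightarrow> z p) F"
  shows "((\<lambda>t. pure_tensor (y t)) \<longlongrightarrow> pure_tensor z) F"
  unfolding pure_tensor_def by (intro tendsto_vec_lambda tendsto_prod tendsto_vec_nth assms)

text \<open>\<open>spread S\<close> depends only on \<open>S\<close>, so the permutations stay fixed
  while \<open>x\<close> and \<open>T\<close> vary, and every entry is a polynomial in both.\<close>

lemma tendsto_rebalance:
  assumes "(x \<longlongrightarrow> x0) F" "(T \<longlongrightarrow> T0) F"
  shows "((\<lambda>t. rebalance (x t) (T t)) \<longlongrightarrow> rebalance x0 T0) F"
proof -
  have "((\<lambda>t. split_vec (x t) S p y) \<longlongrightarrow> split_vec x0 S p y) F" for S p y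
    unfolding split_vec_def by (cases "p \<in> S") (auto intro!: tendsto_intros assms)
  then show ?thesis
    unfolding rebalance_def permute_tensor_def split_tensor_def
    by (intro tendsto_sum tendsto_vec_lambda tendsto_vec_nth tendsto_inner assms tendsto_pure_tensor)
qed

section \<open>Criticality of maximizers on the sphere\<close>

text \<open>Homogeneity extends maximality to a bound by m |u|^d for all \<open>u\<close>. The
  defect \<open>h\<close> along x + t z is then minimal at t = 0; since \<open>z\<close> is
  orthogonal to \<open>x\<close>, the norm has no first-order term, so the values with
  \<open>z\<close> in a single slot sum to 0. Symmetry of \<open>A\<close> makes them all
  equal.\<close>

lemma sphere_maximizer_critical:
  fixes A :: "('d::finite, 'n::finite) tensor"
  assumes sym: "A \<in> symmetric_tensors" and x: "norm x = 1"
    and max: "\<And>u. norm u = 1 \<Longrightarrow> A \<bullet> pure_tensor (\<lambda>_. u) \<le> A \<bullet> pure_tensor (\<lambda>_. x)"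
    and z: "x \<bullet> z = 0"
  shows "A \<bullet> pure_tensor ((\<lambda>_. x)(p := z)) = 0"
proof -
  define m where "m = A \<bullet> pure_tensor (\<lambda>_. x)"
  define d where "d = CARD('d)"
  have scale: "A \<bullet> pure_tensor (\<lambda>_. c *\<^sub>R u) = c ^ d * (A \<bullet> pure_tensor (\<lambda>_. u))" for c u
    by (simp add: pure_tensor_scaleR d_def)
  have bound: "A \<bullet> pure_tensor (\<lambda>_. u) \<le> m * norm u ^ d" for u
  proof (cases "u = 0")
    case True
    then show ?thesis by (simp add: pure_tensor_eq_0 d_def power_0_left)
  next
    case False
    then have "A \<bullet> pure_tensor (\<lambda>_. u /\<^sub>R norm u) \<le> m" unfolding m_def by (intro max) simp
    then have "norm u ^ d * (A \<bullet> pure_tensor (\<lambda>_. u /\<^sub>R norm u)) \<le> norm u ^ d * m"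
      by (intro mult_left_mono) auto
    then show ?thesis using False by (simp add: scale[symmetric] mult.commute)
  qed
  define a where "a = (\<lambda>S. A \<bullet> pure_tensor (\<lambda>p. if p \<in> S then z else x))"
  define h where "h = (\<lambda>t. m * sqrt (1 + t\<^sup>2 * (z \<bullet> z)) ^ d - (\<Sum>S\<in>UNIV. t ^ card S * a S))"
  have expand: "A \<bullet> pure_tensor (\<lambda>_. t *\<^sub>R z + x) = (\<Sum>S\<in>UNIV. t ^ card S * a S)" for t
  proof -
    have "pure_tensor (\<lambda>p. if p \<in> S then t *\<^sub>R z else x)
        = t ^ card S *\<^sub>R pure_tensor (\<lambda>p. if p \<in> S then z else x)" for S :: "'d set"
    proof -
      have "pure_tensor (\<lambda>p. if p \<in> S then t *\<^sub>R z else x)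
          = pure_tensor (\<lambda>p. (if p \<in> S then t else 1) *\<^sub>R (if p \<in> S then z else x))"
        by (intro arg_cong[of _ _ pure_tensor]) auto
      also have "\<dots> = t ^ card S *\<^sub>R pure_tensor (\<lambda>p. if p \<in> S then z else x)"
        by (simp add: pure_tensor_scaleR prod.If_cases)
      finally show ?thesis .
    qed
    then show ?thesis by (simp add: pure_tensor_add inner_sum_right a_def)
  qed
  have h_eq: "h t = m * norm (t *\<^sub>R z + x) ^ d - A \<bullet> pure_tensor (\<lambda>_. t *\<^sub>R z + x)" for t
  proof -
    have "(t *\<^sub>R z + x) \<bullet> (t *\<^sub>R z + x) = 1 + t\<^sup>2 * (z \<bullet> z)"
      using x z by (simp add: inner_add_left inner_add_right inner_commute[of z x] norm_eq_1
          power2_eq_square)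
    then have "norm (t *\<^sub>R z + x) = sqrt (1 + t\<^sup>2 * (z \<bullet> z))"
      by (simp only: norm_eq_sqrt_inner)
    then show ?thesis by (simp only: h_def expand)
  qed
  have "h 0 \<le> h t" for t
    using bound[of "t *\<^sub>R z + x"] by (simp add: h_eq x m_def)
  moreover have "(h has_real_derivative - (\<Sum>p\<in>UNIV. a {p})) (at 0)"
  proof -
    \<comment> \<open>For the empty set the truncated exponent makes the power 1, but the factor
      \<open>real (card S)\<close> is 0; exactly the singletons survive.\<close>
    have "(\<Sum>S\<in>UNIV. real (card S) * 0 ^ (card S - 1) * a S) = (\<Sum>S | card S = 1. a S)"
      by (rule sum.mono_neutral_cong_right) (auto simp: power_0_left le_Suc_eq)
    also have "\<dots> = (\<Sum>p\<in>UNIV. a {p})" by (rule sum_card_1)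
    finally have s: "(\<Sum>p\<in>UNIV. a {p}) = (\<Sum>S\<in>UNIV. real (card S) * 0 ^ (card S - 1) * a S)" ..
    show ?thesis
      unfolding h_def s
      by (rule derivative_eq_intros refl | simp)+
  qed
  ultimately have sum0: "(\<Sum>p\<in>UNIV. a {p}) = 0"
    using DERIV_local_min[of h "- (\<Sum>p\<in>UNIV. a {p})" 0 1] by auto
  have "a {q} = a {p}" for q
  proof -
    let ?s = "Transposition.transpose p q"
    have s: "?s permutes UNIV" by (simp add: permutes_swap_id)
    have "a {q} = permute_tensor ?s A \<bullet> pure_tensor (\<lambda>r. if r \<in> {q} then z else x)"
      using permute_symmetric_tensor[OF sym s] by (simp add: a_def)
    also have "\<dots> = A \<bullet> pure_tensor ((\<lambda>r. if r \<in> {q} then z else x) \<circ> ?s)"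
      using s by (simp add: permute_tensor_inner_pure permutes_bij)
    also have "(\<lambda>r. if r \<in> {q} then z else x) \<circ> ?s = (\<lambda>r. if r \<in> {p} then z else x)"
      by (auto simp: Transposition.transpose_def fun_eq_iff)
    finally show ?thesis by (simp add: a_def)
  qed
  then have "(\<Sum>q\<in>UNIV. a {q}) = (\<Sum>q\<in>(UNIV :: 'd set). a {p})" by (rule sum.cong[OF refl])
  with sum0 have "a {p} = 0" by simp
  moreover have "(\<lambda>r. if r \<in> {p} then z else x) = (\<lambda>_. x)(p := z)" by auto
  ultimately show ?thesis by (simp add: a_def)
qed

section \<open>Rank-one reshapings\<close>

definition outer_tensor :: "real ^ ('k \<Rightarrow> 'n) \<Rightarrow> real ^ ('k \<Rightarrow> 'n) \<Rightarrow> ('k::finite + 'k, 'n::finite) tensor"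
  where "outer_tensor a b = (\<chi> i. a $ (i \<circ> Inl) * b $ (i \<circ> Inr))"

lemma case_sum_comp: "case_sum (i \<circ> Inl) (i \<circ> Inr) = i"
  by (auto simp: fun_eq_iff split: sum.split)

lemma tensor_Mat_nth: "T $ i = tensor_Mat T $ (i \<circ> Inl) $ (i \<circ> Inr)"
  by (simp add: tensor_Mat_def case_sum_comp)

lemma tensor_Mat_outer: "tensor_Mat (outer_tensor a b) = (\<chi> r c. a $ r * b $ c)"
  by (simp add: tensor_Mat_def outer_tensor_def comp_def)

lemma tensor_Mat_inj: "tensor_Mat T = tensor_Mat T' \<Longrightarrow> T = T'"
  by (simp add: vec_eq_iff[of T] tensor_Mat_nth[of T] tensor_Mat_nth[of T'])

text \<open>Turns the linear functional of the KKT inequality, at \<open>outer_tensor u u\<close>,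
  into the quadratic form of the reshaped matrix.\<close>

lemma inner_outer_tensor:
  fixes T :: "('k::finite + 'k, 'n::finite) tensor"
  shows "T \<bullet> outer_tensor a b = a \<bullet> (tensor_Mat T *v b)"
proof -
  have "T \<bullet> outer_tensor a b = (\<Sum>i\<in>UNIV. T $ i * (a $ (i \<circ> Inl) * b $ (i \<circ> Inr)))"
    by (simp add: inner_vec_def outer_tensor_def)
  also have "\<dots> = (\<Sum>(r, c)\<in>UNIV \<times> UNIV. T $ case_sum r c * (a $ r * b $ c))"
    by (rule sum.reindex_bij_witness[of _ "\<lambda>(r, c). case_sum r c" "\<lambda>i. (i \<circ> Inl, i \<circ> Inr)"])
       (auto simp: case_sum_comp[unfolded comp_def] comp_def)
  also have "\<dots> = (\<Sum>r\<in>UNIV. \<Sum>c\<in>UNIV. T $ case_sum r c * (a $ r * b $ c))"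
    by (simp only: sum.cartesian_product)
  also have "\<dots> = a \<bullet> (tensor_Mat T *v b)"
    by (simp add: inner_vec_def matrix_vector_mult_def
        tensor_Mat_def sum_distrib_left mult_ac)
  finally show ?thesis .
qed

lemma outer_tensor_mult: "tensor_Mat (outer_tensor a b) *v x = (b \<bullet> x) *\<^sub>R a"
  by (simp add: tensor_Mat_outer vec_eq_iff matrix_vector_mult_def inner_vec_def sum_distrib_left mult_ac)

lemma outer_tensor_inner: "outer_tensor a b \<bullet> outer_tensor c d = (a \<bullet> c) * (b \<bullet> d)"
  by (simp add: inner_outer_tensor outer_tensor_mult inner_commute)

lemma norm_outer_tensor: "norm (outer_tensor a b) = norm a * norm b"
  by (simp add: norm_eq_sqrt_inner outer_tensor_inner real_sqrt_mult)

lemma pure_tensor_eq_outer: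
  fixes y :: "'k::finite + 'k \<Rightarrow> real ^ 'n::finite"
  shows "pure_tensor y = outer_tensor (pure_tensor (y \<circ> Inl)) (pure_tensor (y \<circ> Inr))"
proof -
  have "(\<Prod>p\<in>UNIV. f p) = (\<Prod>q\<in>UNIV. f (Inl q)) * (\<Prod>q\<in>UNIV. f (Inr q))"
    for f :: "'k + 'k \<Rightarrow> real"
    by (simp add: UNIV_Plus_UNIV[symmetric] prod.Plus comp_def del: UNIV_Plus_UNIV)
  then show ?thesis by (simp add: pure_tensor_def outer_tensor_def)
qed

lemma norm_pure_tensor_const:
  "norm x = 1 \<Longrightarrow> norm (pure_tensor (\<lambda>_::'d::finite. x)) = 1"
  by (simp add: norm_eq_1 pure_tensor_inner_pure_tensor)

section \<open>The shape of feasible points\<close>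

text \<open>All columns are multiples of one vector \<open>a\<close>; symmetry forces the
  multipliers to be proportional to \<open>a\<close>, so the entries are e a_i a_j. Trace one gives
  e (a \<bullet> a) = 1, hence e > 0 and the unit vector sqrt e a.\<close>

lemma rank_1_symmetricE:
  fixes M :: "real ^ 'm ^ 'm"
  assumes "rank M = 1" "symmetric_matrix M" "trace M = 1"
  obtains u where "norm u = 1" "M = (\<chi> i j. u $ i * u $ j)"
proof -
  have d: "dim (range (\<lambda>x. M *v x)) = 1" using assms(1) by (simp add: rank_dim_range)
  obtain B where B: "independent B" "range (\<lambda>x. M *v x) \<subseteq> span B" "card B = 1"
    using basis_exists[of "range (\<lambda>x. M *v x)"] d by metis
  obtain a where a: "B = {a}" using B(3) by (auto simp: card_1_singleton_iff)
  have a0: "a \<noteq> 0" using B(1) a dependent_zero[of B] by auto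
  have "\<exists>c. M *v axis j 1 = c *\<^sub>R a" for j
    using B(2) unfolding a span_singleton by auto
  then obtain c where c: "\<And>j. M *v axis j 1 = c j *\<^sub>R a" by metis
  have Mij: "M $ i $ j = c j * a $ i" for i j
    using arg_cong[OF c[of j], of "\<lambda>x. x $ i"] by (simp add: matrix_vector_mult_basis column_def)
  have Msym: "M $ i $ j = M $ j $ i" for i j
  proof -
    have "transpose M $ i $ j = M $ i $ j" using assms(2) by (simp add: symmetric_matrix_def)
    then show ?thesis by (simp add: transpose_def)
  qed
  obtain k where k: "a $ k \<noteq> 0" using a0 by (auto simp: vec_eq_iff)
  define e where "e = c k / a $ k"
  have "c j = e * a $ j" for j
    using Msym[of j k] k by (simp add: Mij e_def field_simps)
  then have Me: "M $ i $ j = e * (a $ i * a $ j)" for i j by (simp add: Mij)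
  have "e * (a \<bullet> a) = 1"
    using assms(3) by (simp add: trace_def Me inner_vec_def sum_distrib_left)
  then have e: "e > 0" "e * (norm a)\<^sup>2 = 1"
    using inner_ge_zero[of a] by (metis zero_less_mult_pos2 a0 inner_gt_zero_iff zero_less_one,
      simp add: power2_norm_eq_inner)
  show ?thesis
  proof (rule that[of "sqrt e *\<^sub>R a"])
    have "(norm (sqrt e *\<^sub>R a))\<^sup>2 = 1" using e by (simp add: power_mult_distrib)
    then show "norm (sqrt e *\<^sub>R a) = 1" 
      using power2_eq_imp_eq[of "norm (sqrt e *\<^sub>R a)" 1] by (simp del: norm_scaleR)
    have "(sqrt e *\<^sub>R a) $ i * (sqrt e *\<^sub>R a) $ j = e * (a $ i * a $ j)" for i j
    proof -
      have "(sqrt e *\<^sub>R a) $ i * (sqrt e *\<^sub>R a) $ j = (sqrt e * sqrt e) * (a $ i * a $ j)"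
        by (simp only: vector_scaleR_component real_scaleR_def mult_ac)
      then show ?thesis using e(1) by simp
    qed
    then show "M = (\<chi> i j. (sqrt e *\<^sub>R a) $ i * (sqrt e *\<^sub>R a) $ j)"
      by (simp only: vec_eq_iff Me vec_lambda_beta simp_thms)
  qed
qed

lemma feasible_set_iff:
  fixes X :: "('k::finite + 'k, 'n::finite) tensor"
  shows "X \<in> feasible_set \<longleftrightarrow> (\<exists>u. norm u = 1 \<and> X = outer_tensor u u)"
proof
  assume "X \<in> feasible_set"
  then obtain u where "norm u = 1" "tensor_Mat X = (\<chi> i j. u $ i * u $ j)"
    using rank_1_symmetricE[of "tensor_Mat X"] unfolding feasible_set_def by blast
  then show "\<exists>u. norm u = 1 \<and> X = outer_tensor u u"
    by (auto intro!: exI[of _ u] tensor_Mat_inj simp: tensor_Mat_outer)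
next
  assume "\<exists>u. norm u = 1 \<and> X = outer_tensor u u"
  then obtain u where u: "norm u = 1" "X = outer_tensor u u" by blast
  have uu: "u \<bullet> u = 1" using u by (simp add: norm_eq_1)
  have "range (\<lambda>x. tensor_Mat X *v x) = span {u}"
  proof -
    have "k *\<^sub>R u \<in> range (\<lambda>x. (u \<bullet> x) *\<^sub>R u)" for k
      by (rule range_eqI[of _ _ "k *\<^sub>R u"]) (simp add: uu)
    then show ?thesis by (auto simp: u outer_tensor_mult span_singleton)
  qed
  then have "rank (tensor_Mat X) = 1"
    using u(1) by (auto simp: rank_dim_range dim_eq_card_independent dependent_single)
  moreover have "symmetric_matrix (tensor_Mat X)"
    by (simp add: u tensor_Mat_outer symmetric_matrix_def transpose_def mult.commute)
  moreover have "trace (tensor_Mat X) = 1"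
    using uu by (simp add: u tensor_Mat_outer trace_def inner_vec_def)
  ultimately show "X \<in> feasible_set" by (simp add: feasible_set_def)
qed

text \<open>Symmetry allows a row index to be exchanged with a column index. Against a fixed nonzero
  entry \<open>u $ r0\<close> this splits off one factor \<open>f (r p)\<close> per position, so
  \<open>u\<close> is a multiple of y \<otimes> ... \<otimes> y. After normalization the multiple is
  a sign, which enters twice and cancels.\<close>

lemma outer_tensor_symmetricE:
  fixes u :: "real ^ ('k::finite \<Rightarrow> 'n::finite)"
  assumes u: "norm u = 1" and sym: "outer_tensor u u \<in> symmetric_tensors"
  obtains x where "norm x = 1" "outer_tensor u u = pure_tensor (\<lambda>_. x)"
proof -
  obtain r0 where r0: "u $ r0 \<noteq> 0" using u by (metis norm_zero vec_eq_iff zero_index zero_neq_one)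
  \<comment> \<open>Any position will do; the value of \<open>r0\<close> there becomes the base
    value \<open>a0\<close> that replaces the indices already split off.\<close>
  obtain q :: 'k where True by simp
  define a0 where "a0 = r0 q"
  define f where "f = (\<lambda>b. u $ (r0(q := b)) / u $ r0)"
  have swap: "u $ (r(p := b)) * u $ r0 = u $ (r(p := a0)) * u $ (r0(q := b))" for r p b
  proof -
    let ?i = "case_sum (r(p := b)) r0"
    let ?s = "Transposition.transpose (Inl p) (Inr q)"
    have "outer_tensor u u $ ?i = outer_tensor u u $ (?i \<circ> ?s)"
      using sym permutes_swap_id[of "Inl p" UNIV "Inr q"] by (simp add: symmetric_tensors_def)
    moreover have "?i \<circ> ?s \<circ> Inl = r(p := a0)" "?i \<circ> ?s \<circ> Inr = r0(q := b)"
      by (auto simp: fun_eq_iff Transposition.transpose_def a0_def)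
    moreover have "?i \<circ> Inl = r(p := b)" "?i \<circ> Inr = r0" by (auto simp: fun_eq_iff)
    ultimately show ?thesis by (simp only: outer_tensor_def vec_lambda_beta)
  qed
  have step: "u $ r = f (r p) * u $ (r(p := a0))" for r p
    using swap[of r p "r p"] r0 by (simp add: f_def field_simps)
  have ur_on: "u $ r = (\<Prod>p\<in>S. f (r p)) * u $ (\<lambda>p. if p \<in> S then a0 else r p)" if "finite S" for r S
    using that
  proof induction
    case (insert p S)
    have "(\<lambda>p'. if p' \<in> S then a0 else r p')(p := a0) = (\<lambda>p'. if p' \<in> insert p S then a0 else r p')"
      by auto
    with step[of "\<lambda>p. if p \<in> S then a0 else r p" p] insert show ?case by simp
  qed simp
  have ur: "u $ r = (\<Prod>p\<in>UNIV. f (r p)) * u $ (\<lambda>_. a0)" for r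
    using ur_on[OF finite, of r UNIV] by (simp only: UNIV_I if_True)
  define y where "y = (\<chi> b. f b)"
  define x where "x = y /\<^sub>R norm y"
  have uy: "u = (u $ (\<lambda>_. a0)) *\<^sub>R pure_tensor (\<lambda>_. y)"
    unfolding vec_eq_iff
  proof
    show "u $ r = (u $ (\<lambda>_. a0) *\<^sub>R pure_tensor (\<lambda>_. y)) $ r" for r
      by (subst ur) (simp add: pure_tensor_def y_def mult.commute)
  qed
  have "y \<noteq> 0" using uy u by (metis norm_zero pure_tensor_eq_0 scaleR_zero_right zero_neq_one)
  then have x: "norm x = 1" "y = norm y *\<^sub>R x" by (auto simp: x_def)
  define e where "e = u $ (\<lambda>_. a0) * norm y ^ CARD('k)"
  have "pure_tensor (\<lambda>_::'k. norm y *\<^sub>R x) = norm y ^ CARD('k) *\<^sub>R pure_tensor (\<lambda>_. x)"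
    by (simp add: pure_tensor_scaleR)
  then have ux: "u = e *\<^sub>R pure_tensor (\<lambda>_. x)"
    using uy x(2) by (simp add: e_def)
  have "\<bar>e\<bar> = 1" using u norm_pure_tensor_const[OF x(1), where 'd = 'k] by (simp add: ux)
  then have "e * e = 1" by (auto simp: abs_if split: if_splits)
  then have "outer_tensor u u = outer_tensor (pure_tensor (\<lambda>_. x)) (pure_tensor (\<lambda>_. x))"
    by (subst (1 2) ux) (simp add: outer_tensor_def vec_eq_iff mult.assoc[symmetric] mult.left_commute)
  also have "\<dots> = pure_tensor (\<lambda>_. x)"
    by (simp add: pure_tensor_eq_outer[of "\<lambda>_. x"] comp_def)
  finally show ?thesis using that x(1) by blast
qed

section \<open>Perturbation of certificates\<close>

lemma pure_tensor_even:
  "pure_tensor (\<lambda>_::'k::finite + 'k. - z) = pure_tensor (\<lambda>_. z)"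
  by (simp add: pure_tensor_eq_outer comp_def)
     (simp add: outer_tensor_def pure_tensor_def vec_eq_iff prod_uminus mult_ac)

text \<open>The order is even, so \<open>z\<close> and \<open>- z\<close> give the same value and
  the sign of a maximizer can be chosen relative to \<open>x\<close>.\<close>

lemma sphere_maximizer_exists:
  fixes A :: "('k::finite + 'k, 'n::finite) tensor"
  obtains z where "norm z = 1" "0 \<le> z \<bullet> x"
    "\<And>u. norm u = 1 \<Longrightarrow> A \<bullet> pure_tensor (\<lambda>_. u) \<le> A \<bullet> pure_tensor (\<lambda>_. z)"
proof -
  let ?f = "\<lambda>u :: real ^ 'n. A \<bullet> pure_tensor (\<lambda>_. u)"
  have "continuous_on (sphere 0 1) ?f"
    unfolding pure_tensor_def by (intro continuous_intros)
  moreover have "sphere 0 1 \<noteq> ({} :: (real ^ 'n) set)" by simp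
  ultimately obtain z where z: "z \<in> sphere 0 1" "\<And>u. u \<in> sphere 0 1 \<Longrightarrow> ?f u \<le> ?f z"
    using continuous_attains_sup[OF compact_sphere] by metis
  show ?thesis
  proof (cases "0 \<le> z \<bullet> x")
    case True
    then show ?thesis using z by (intro that[of z]) auto
  next
    case False
    then show ?thesis using z by (intro that[of "- z"]) (auto simp: pure_tensor_even)
  qed
qed

section \<open>Symmetrizing the reshaping\<close>

definition flip_tensor :: "('k::finite + 'k, 'n::finite) tensor \<Rightarrow> ('k + 'k, 'n) tensor" where
  "flip_tensor = permute_tensor (case_sum Inr Inl)"

lemma flip_permutes: "case_sum Inr Inl permutes (UNIV :: ('k + 'k) set)"
  by (rule bij_imp_permutes) (auto intro!: o_bij[of "case_sum Inr Inl"] simp: fun_eq_iff split: sum.split)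

lemma tensor_Mat_flip: "tensor_Mat (flip_tensor T) = transpose (tensor_Mat T)"
proof -
  have "case_sum r c \<circ> case_sum Inr Inl = case_sum c r" for r c :: "'a \<Rightarrow> 'b"
    by (auto simp: fun_eq_iff split: sum.split)
  then show ?thesis
    by (simp add: tensor_Mat_def flip_tensor_def permute_tensor_def transpose_def)
qed

lemma tensor_Mat_linear: "linear tensor_Mat"
  by (intro linearI) (auto simp: tensor_Mat_def vec_eq_iff)

lemma tendsto_flip_tensor: "(T \<longlongrightarrow> T0) F \<Longrightarrow> ((\<lambda>t. flip_tensor (T t)) \<longlongrightarrow> flip_tensor T0) F"
  unfolding flip_tensor_def permute_tensor_def by (intro tendsto_vec_lambda tendsto_vec_nth)

lemma flip_tensor_inner_pure: "flip_tensor T \<bullet> pure_tensor y = T \<bullet> pure_tensor (y \<circ> case_sum Inr Inl)"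
  by (simp add: flip_tensor_def permute_tensor_inner_pure permutes_bij[OF flip_permutes])

text \<open>Rebalancing need not give a symmetric reshaping. Averaging with the transpose repairs
  this, and since transposing is a permutation of positions, \<open>tensor_Sym\<close> does not see
  it.\<close>

definition mat_symmetrize :: "('k::finite + 'k, 'n::finite) tensor \<Rightarrow> ('k + 'k, 'n) tensor" where
  "mat_symmetrize T = (1 / 2) *\<^sub>R (T + flip_tensor T)"

lemma symmetric_matrix_mat_symmetrize: "symmetric_matrix (tensor_Mat (mat_symmetrize T))"
  by (simp add: symmetric_matrix_def mat_symmetrize_def linear_cmul[OF tensor_Mat_linear]
      linear_add[OF tensor_Mat_linear] tensor_Mat_flip) (simp add: transpose_def vec_eq_iff)

lemma mat_symmetrize_fixed:
  assumes "symmetric_matrix (tensor_Mat T)"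
  shows "mat_symmetrize T = T"
proof -
  have "flip_tensor T = T"
    using assms by (intro tensor_Mat_inj) (simp add: tensor_Mat_flip symmetric_matrix_def)
  then show ?thesis by (simp add: mat_symmetrize_def scaleR_2[symmetric])
qed

lemma tensor_Sym_mat_symmetrize: "tensor_Sym (mat_symmetrize T) = tensor_Sym T"
  by (simp add: mat_symmetrize_def linear_cmul[OF tensor_Sym_linear] linear_add[OF tensor_Sym_linear]
      flip_tensor_def tensor_Sym_permute[OF flip_permutes] scaleR_2[symmetric])

section \<open>Eigenvector equations tested on pure tensors\<close>

text \<open>Supplies the hypothesis of \<open>rebalance_fixed\<close>. Symmetry of the matrix lets
  the eigenvector equation be applied whichever half is filled with \<open>x\<close>.\<close>

lemma eigenvector_pure_tensor:
  fixes L :: "('k::finite + 'k, 'n::finite) tensor"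
  assumes sym: "symmetric_matrix (tensor_Mat L)"
    and ev: "tensor_Mat L *v pure_tensor (\<lambda>_. x) = \<mu> *\<^sub>R pure_tensor (\<lambda>_. x)"
    and x: "x \<bullet> x = 1" and y: "(\<forall>q. y (Inl q) = x) \<or> (\<forall>q. y (Inr q) = x)"
  shows "L \<bullet> pure_tensor y = \<mu> * (\<Prod>p\<in>UNIV. x \<bullet> y p)"
proof -
  let ?v = "pure_tensor (\<lambda>_. x) :: real ^ ('k \<Rightarrow> 'n)"
  have vv: "?v \<bullet> ?v = 1" by (simp add: pure_tensor_inner_pure_tensor x)
  let ?a = "pure_tensor (y \<circ> Inl)" and ?b = "pure_tensor (y \<circ> Inr)"
  have "?a = ?v \<or> ?b = ?v" using y by (auto simp: comp_def)
  then have "?a \<bullet> (tensor_Mat L *v ?b) = \<mu> * ((?v \<bullet> ?a) * (?v \<bullet> ?b))"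
  proof
    assume "?a = ?v"
    then show ?thesis
      using symmetric_matrix_inner[OF sym, of ?v ?b] by (simp add: ev vv inner_commute)
  next
    assume "?b = ?v"
    then show ?thesis by (simp add: ev vv inner_commute)
  qed
  also have "(?v \<bullet> ?a) * (?v \<bullet> ?b) = pure_tensor (\<lambda>_. x) \<bullet> pure_tensor y"
    by (simp add: pure_tensor_eq_outer[of y] pure_tensor_eq_outer[of "\<lambda>_. x"] outer_tensor_inner comp_def)
  also have "\<dots> = (\<Prod>p\<in>UNIV. x \<bullet> y p)" by (rule pure_tensor_inner_pure_tensor)
  finally show ?thesis by (simp only: pure_tensor_eq_outer[of y] inner_outer_tensor)
qed

lemma eigenvector_pure_tensorI:
  fixes L :: "('k::finite + 'k, 'n::finite) tensor"
  assumes x: "x \<bullet> x = 1"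
    and L: "\<And>y. (\<forall>q. y (Inr q) = x) \<Longrightarrow> L \<bullet> pure_tensor y = \<mu> * (\<Prod>p\<in>UNIV. x \<bullet> y p)"
  shows "tensor_Mat L *v pure_tensor (\<lambda>_. x) = \<mu> *\<^sub>R pure_tensor (\<lambda>_. x)"
proof -
  let ?v = "pure_tensor (\<lambda>_. x) :: real ^ ('k \<Rightarrow> 'n)"
  have vv: "?v \<bullet> ?v = 1" by (simp add: pure_tensor_inner_pure_tensor x)
  have "(tensor_Mat L *v ?v) $ r = (\<mu> *\<^sub>R ?v) $ r" for r
  proof -
    \<comment> \<open>Axis vectors in the first half read off row \<open>r\<close> of the
      eigenvector equation.\<close>
    define y :: "'k + 'k \<Rightarrow> real ^ 'n" where "y = case_sum (\<lambda>p. axis (r p) 1) (\<lambda>_. x)"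
    have y: "pure_tensor y = outer_tensor (axis r 1) ?v"
      by (simp add: pure_tensor_eq_outer y_def comp_def pure_tensor_axis)
    have "(tensor_Mat L *v ?v) $ r = L \<bullet> pure_tensor y"
      by (simp add: y inner_outer_tensor inner_axis')
    also have "\<dots> = \<mu> * (\<Prod>p\<in>UNIV. x \<bullet> y p)" by (rule L) (simp add: y_def)
    also have "(\<Prod>p\<in>UNIV. x \<bullet> y p) = pure_tensor (\<lambda>_. x) \<bullet> pure_tensor y"
      by (simp add: pure_tensor_inner_pure_tensor)
    also have "\<dots> = ?v $ r"
      by (simp add: y pure_tensor_eq_outer[of "\<lambda>_. x"] outer_tensor_inner comp_def vv inner_axis)
    finally show ?thesis by simp
  qed
  then show ?thesis by (simp only: vec_eq_iff simp_thms)
qed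

text \<open>Maximality makes \<open>x\<close> critical, so dropping the singleton components does
  not change the symmetrization. The flip exchanges the two kinds of half-constant arguments, so
  both summands of \<open>mat_symmetrize\<close> give the same value.\<close>

lemma rebalance_certificate:
  fixes T :: "('k::finite + 'k, 'n::finite) tensor"
  assumes A: "tensor_Sym T = A" "A \<in> symmetric_tensors" and x: "norm x = 1"
    and max: "\<And>u. norm u = 1 \<Longrightarrow> A \<bullet> pure_tensor (\<lambda>_. u) \<le> A \<bullet> pure_tensor (\<lambda>_. x)"
  shows "tensor_Sym (mat_symmetrize (rebalance x T)) = A"
    "tensor_Mat (mat_symmetrize (rebalance x T)) *v pure_tensor (\<lambda>_. x)
      = (A \<bullet> pure_tensor (\<lambda>_. x)) *\<^sub>R pure_tensor (\<lambda>_. x)"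
proof -
  have xx: "x \<bullet> x = 1" using x by (simp add: norm_eq_1)
  show "tensor_Sym (mat_symmetrize (rebalance x T)) = A"
    using sphere_maximizer_critical[OF A(2) x max] A(1)
    by (simp add: tensor_Sym_mat_symmetrize tensor_Sym_rebalance xx)
  have Ax: "T \<bullet> pure_tensor (\<lambda>_. x) = A \<bullet> pure_tensor (\<lambda>_. x)"
    using tensor_Sym_inner_pure_const[of T x] A(1) by simp
  show "tensor_Mat (mat_symmetrize (rebalance x T)) *v pure_tensor (\<lambda>_. x)
      = (A \<bullet> pure_tensor (\<lambda>_. x)) *\<^sub>R pure_tensor (\<lambda>_. x)"
  proof (rule eigenvector_pure_tensorI[OF xx])
    fix y :: "'k + 'k \<Rightarrow> real ^ 'n"
    assume y: "\<forall>q. y (Inr q) = x"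
    let ?y = "y \<circ> case_sum Inr Inl"
    have "rebalance x T \<bullet> pure_tensor y = (\<Prod>p\<in>UNIV. x \<bullet> y p) * (A \<bullet> pure_tensor (\<lambda>_. x))"
      using y by (simp add: rebalance_inner_pure[OF xx] Ax)
    moreover have "rebalance x T \<bullet> pure_tensor ?y = (\<Prod>p\<in>UNIV. x \<bullet> ?y p) * (A \<bullet> pure_tensor (\<lambda>_. x))"
      using y by (simp add: rebalance_inner_pure[OF xx] Ax)
    moreover have "(\<Prod>p\<in>UNIV. x \<bullet> ?y p) = (\<Prod>p\<in>UNIV. x \<bullet> y p)"
      using prod.permute[OF flip_permutes, of "\<lambda>p. x \<bullet> y p"] by (simp add: comp_def)
    ultimately show "mat_symmetrize (rebalance x T) \<bullet> pure_tensor y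
        = (A \<bullet> pure_tensor (\<lambda>_. x)) * (\<Prod>p\<in>UNIV. x \<bullet> y p)"
      by (simp add: mat_symmetrize_def inner_add_left flip_tensor_inner_pure)
  qed
qed

section \<open>Certificates as spectral gaps\<close>

text \<open>The gap bounds the Rayleigh quotient of \<open>L\<close> by \<mu>, which is attained at
  the power of \<open>x\<close>. This is the KKT inequality for X = Y = x \<otimes> ... \<otimes>
  x.\<close>

lemma KKT_tensors_plusI:
  fixes L :: "('k::finite + 'k, 'n::finite) tensor"
  assumes A: "tensor_Sym L = A" "A \<in> symmetric_tensors" and x: "norm x = 1"
    and sym: "symmetric_matrix (tensor_Mat L)"
    and ev: "tensor_Mat L *v pure_tensor (\<lambda>_. x) = \<mu> *\<^sub>R pure_tensor (\<lambda>_. x)"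
    and gap: "\<And>w. w \<noteq> 0 \<Longrightarrow> w \<bullet> pure_tensor (\<lambda>_. x) = 0 \<Longrightarrow> w \<bullet> (tensor_Mat L *v w) < \<mu> * (w \<bullet> w)"
  shows "A \<in> KKT_tensors_plus"
proof -
  let ?v = "pure_tensor (\<lambda>_. x) :: real ^ ('k \<Rightarrow> 'n)"
  let ?X = "pure_tensor (\<lambda>_. x) :: ('k + 'k, 'n) tensor"
  have v: "norm ?v = 1" by (rule norm_pure_tensor_const[OF x])
  note lead = gap_imp_leading_simple_eigenvalue[OF sym v ev gap]
  have X: "?X = outer_tensor ?v ?v" by (simp add: pure_tensor_eq_outer comp_def)
  have "(- L) \<bullet> (Z - ?X) \<ge> 0" if "Z \<in> feasible_set" for Z
  proof -
    obtain u where u: "norm u = 1" "Z = outer_tensor u u" using \<open>Z \<in> feasible_set\<close> feasible_set_iff by blast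
    have "L \<bullet> Z \<le> \<mu>" using lead(3)[of u] u by (simp add: inner_outer_tensor norm_eq_1)
    moreover have "L \<bullet> ?X = \<mu>" using v by (simp add: X inner_outer_tensor ev norm_eq_1)
    ultimately show ?thesis by (simp add: inner_diff_right)
  qed
  moreover have "?X \<in> feasible_set" unfolding feasible_set_iff using X v by blast
  ultimately have "KKT_solution A ?X ?X L"
    using A by (simp add: KKT_solution_def pure_tensor_const_symmetric)
  then show ?thesis
    using A(2) sym lead(1,2) unfolding KKT_tensors_plus_def KKT_tensors_def by blast
qed

text \<open>The point X = Y is feasible and symmetric, hence a power of a unit vector
  \<open>x\<close>. The KKT inequality says that the half-order power of \<open>x\<close> maximizes
  the Rayleigh quotient, so simplicity yields the gap.\<close>

lemma KKT_tensors_plusE: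
  fixes A :: "('k::finite + 'k, 'n::finite) tensor"
  assumes "A \<in> KKT_tensors_plus"
  obtains L \<mu> \<gamma> x where "tensor_Sym L = A" "symmetric_matrix (tensor_Mat L)" "norm x = 1" "\<gamma> > 0"
    "tensor_Mat L *v pure_tensor (\<lambda>_. x) = \<mu> *\<^sub>R pure_tensor (\<lambda>_. x)"
    "\<And>z. z \<bullet> (tensor_Mat L *v z) \<le> \<mu> * (z \<bullet> z) - \<gamma> * (z \<bullet> z - (z \<bullet> pure_tensor (\<lambda>_. x))\<^sup>2)"
proof -
  obtain X L \<mu> where KKT: "KKT_solution A X X L" and sym: "symmetric_matrix (tensor_Mat L)"
    and lead: "leading_eigenvalue (tensor_Mat L) \<mu>" "simple_eigenvalue (tensor_Mat L) \<mu>"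
    using assms unfolding KKT_tensors_plus_def KKT_solution_def by blast
  obtain u where u: "norm u = 1" "X = outer_tensor u u"
    using KKT feasible_set_iff unfolding KKT_solution_def by blast
  obtain x where x: "norm x = 1" "X = pure_tensor (\<lambda>_. x)"
    using outer_tensor_symmetricE[OF u(1)] KKT u(2) unfolding KKT_solution_def by metis
  let ?v = "pure_tensor (\<lambda>_. x) :: real ^ ('k \<Rightarrow> 'n)"
  have v: "norm ?v = 1" by (rule norm_pure_tensor_const[OF x(1)])
  have X: "X = outer_tensor ?v ?v" by (simp add: x(2) pure_tensor_eq_outer[of "\<lambda>_. x"] comp_def)
  have "w \<bullet> (tensor_Mat L *v w) \<le> ?v \<bullet> (tensor_Mat L *v ?v)" if "norm w = 1" for w
  proof -
    have "outer_tensor w w \<in> feasible_set" using that feasible_set_iff by blast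
    then have "(- L) \<bullet> (outer_tensor w w - X) \<ge> 0" using KKT by (simp add: KKT_solution_def)
    then show ?thesis by (simp add: X inner_diff_right inner_outer_tensor[of L])
  qed
  then show ?thesis
    using leading_simple_eigenvalue_imp_gap[OF sym v _ lead] that[OF _ sym x(1)] KKT
    unfolding KKT_solution_def by metis
qed

lemma KKT_tensors_plus_eventually:
  fixes A :: "('k::finite + 'k, 'n::finite) tensor"
  assumes "A \<in> KKT_tensors_plus"
  shows "\<forall>\<^sub>F B in at A within symmetric_tensors. B \<in> KKT_tensors_plus"
proof -
  let ?F = "at A within symmetric_tensors"
  let ?V = "\<lambda>z. pure_tensor (\<lambda>_. z) :: real ^ ('k \<Rightarrow> 'n)"
  let ?P = "\<lambda>z. pure_tensor (\<lambda>_. z) :: ('k + 'k, 'n) tensor"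
  have Asym: "A \<in> symmetric_tensors" using assms by (auto simp: KKT_tensors_plus_def KKT_tensors_def)
  obtain L \<mu> \<gamma> x where LA: "tensor_Sym L = A" and sym: "symmetric_matrix (tensor_Mat L)"
    and x: "norm x = 1" and \<gamma>: "\<gamma> > 0" and ev: "tensor_Mat L *v ?V x = \<mu> *\<^sub>R ?V x"
    and gap: "\<And>z. z \<bullet> (tensor_Mat L *v z) \<le> \<mu> * (z \<bullet> z) - \<gamma> * (z \<bullet> z - (z \<bullet> ?V x)\<^sup>2)"
    using KKT_tensors_plusE[OF assms] by metis
  have xx: "x \<bullet> x = 1" using x by (simp add: norm_eq_1)
  have P: "?P z = outer_tensor (?V z) (?V z)" for z
    by (simp add: pure_tensor_eq_outer[of "\<lambda>_. z"] comp_def)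
  have Px: "A \<bullet> ?P x = \<mu>"
    using tensor_Sym_inner_pure_const[of L x] norm_pure_tensor_const[OF x, where 'd = 'k]
    by (simp add: LA P inner_outer_tensor ev norm_eq_1)
  have Pbound: "A \<bullet> ?P z \<le> \<mu> - \<gamma> * (1 - z \<bullet> x)" if z: "norm z = 1" "0 \<le> z \<bullet> x" for z
  proof -
    have zx: "z \<bullet> x \<le> 1" using norm_cauchy_schwarz[of z x] z x by simp
    have "A \<bullet> ?P z = ?V z \<bullet> (tensor_Mat L *v ?V z)"
      using tensor_Sym_inner_pure_const[of L z] by (simp add: LA P inner_outer_tensor)
    also have "\<dots> \<le> \<mu> - \<gamma> * (1 - (?V z \<bullet> ?V x)\<^sup>2)"
      using gap[of "?V z"] norm_pure_tensor_const[OF z(1), where 'd = 'k] by (simp add: norm_eq_1)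
    also have "(?V z \<bullet> ?V x)\<^sup>2 = (z \<bullet> x) ^ (CARD('k) * 2)"
      by (simp add: pure_tensor_inner_pure_tensor power_mult)
    \<comment> \<open>For 0 \<le> z \<bullet> x \<le> 1 a power with exponent at least 1 is at most
      the base; hence the sign normalization of the maximizers.\<close>
    also have "\<mu> - \<gamma> * (1 - (z \<bullet> x) ^ (CARD('k) * 2)) \<le> \<mu> - \<gamma> * (1 - z \<bullet> x)"
      using power_decreasing[of 1 "CARD('k) * 2" "z \<bullet> x"] zx z(2) \<gamma> by (simp add: Suc_le_eq)
    finally show ?thesis .
  qed
  have "\<exists>z. norm z = 1 \<and> 0 \<le> z \<bullet> x \<and> (\<forall>u. norm u = 1 \<longrightarrow> B \<bullet> ?P u \<le> B \<bullet> ?P z)" for B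
    using sphere_maximizer_exists[of x B] by metis
  then obtain m where m: "\<And>B. norm (m B) = 1" "\<And>B. 0 \<le> m B \<bullet> x"
    "\<And>B u. norm u = 1 \<Longrightarrow> B \<bullet> ?P u \<le> B \<bullet> ?P (m B)"
    by metis
  \<comment> \<open>The choice \<open>m\<close> is not known to be continuous, but here it is
    controlled at \<open>A\<close>. Passing between the objectives of \<open>A\<close> and
    \<open>B\<close> at \<open>x\<close> and at \<open>m B\<close> costs \<open>norm (B - A)\<close>
    each time; the other factor 2 comes from |m B - x|^2 = 2 (1 - m B \<bullet> x).\<close>
  have near: "norm (m B - x) \<le> sqrt (4 / \<gamma> * norm (B - A))" for B
  proof -
    have nP: "\<bar>(B - A) \<bullet> ?P u\<bar> \<le> norm (B - A)" if "norm u = 1" for u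
      using Cauchy_Schwarz_ineq2[of "B - A" "?P u"] norm_pure_tensor_const[OF that, where 'd = "'k + 'k"]
      by simp
    have "\<mu> \<le> B \<bullet> ?P x + norm (B - A)" using nP[OF x] Px by (simp add: inner_diff_left)
    also have "B \<bullet> ?P x \<le> B \<bullet> ?P (m B)" by (rule m(3)[OF x])
    also have "B \<bullet> ?P (m B) \<le> A \<bullet> ?P (m B) + norm (B - A)"
      using nP[OF m(1)[of B]] by (simp add: inner_diff_left)
    also have "A \<bullet> ?P (m B) \<le> \<mu> - \<gamma> * (1 - m B \<bullet> x)" by (rule Pbound[OF m(1,2)])
    finally have "\<gamma> * (1 - m B \<bullet> x) \<le> 2 * norm (B - A)" by simp
    then have "1 - m B \<bullet> x \<le> 2 * norm (B - A) / \<gamma>" using \<gamma> by (simp add: field_simps)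
    moreover have "(norm (m B - x))\<^sup>2 = 2 * (1 - m B \<bullet> x)"
      using m(1)[of B] by (simp add: power2_norm_eq_inner inner_diff_left inner_diff_right norm_eq_1 xx
          inner_commute)
    ultimately have "(norm (m B - x))\<^sup>2 \<le> 4 / \<gamma> * norm (B - A)" by simp
    then show ?thesis by (rule real_le_rsqrt)
  qed
  have id: "((\<lambda>B. B) \<longlongrightarrow> A) ?F" by (rule tendsto_ident_at)
  have "((\<lambda>B. sqrt (4 / \<gamma> * norm (B - A))) \<longlongrightarrow> sqrt (4 / \<gamma> * norm (A - A))) ?F"
    by (intro tendsto_intros id)
  moreover have "sqrt (4 / \<gamma> * norm (A - A)) = 0" by simp
  ultimately have "((\<lambda>B. sqrt (4 / \<gamma> * norm (B - A))) \<longlongrightarrow> 0) ?F" by (simp only:)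
  then have "((\<lambda>B. m B - x) \<longlongrightarrow> 0) ?F"
    by (rule Lim_null_comparison[OF always_eventually[OF allI[OF near]]])
  then have mlim: "(m \<longlongrightarrow> x) ?F" by (simp add: LIM_zero_iff)
  define T where "T = (\<lambda>B. L + (B - A))"
  define L' where "L' = (\<lambda>B. mat_symmetrize (rebalance (m B) (T B)))"
  have "(T \<longlongrightarrow> L + (A - A)) ?F" unfolding T_def by (intro tendsto_intros id)
  then have "((\<lambda>B. rebalance (m B) (T B)) \<longlongrightarrow> rebalance x L) ?F"
    by (intro tendsto_rebalance mlim) simp
  moreover have "rebalance x L = L"
    by (rule rebalance_fixed[OF xx eigenvector_pure_tensor[OF sym ev xx]])
  ultimately have "(L' \<longlongrightarrow> mat_symmetrize L) ?F"
    unfolding L'_def mat_symmetrize_def by (intro tendsto_intros tendsto_flip_tensor) simp_all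
  then have L'lim: "(L' \<longlongrightarrow> L) ?F" by (simp add: mat_symmetrize_fixed[OF sym])
  have Vlim: "((\<lambda>B. ?V (m B)) \<longlongrightarrow> ?V x) ?F" by (intro tendsto_pure_tensor mlim)
  \<comment> \<open>The bracket will bound the Rayleigh quotient of \<open>L' B\<close> on the
    complement of \<open>?V (m B)\<close>, and the subtracted term is the new eigenvalue. The limit
    of the difference is -\<gamma>.\<close>
  have "((\<lambda>B. (\<mu> - \<gamma> + \<gamma> * (norm (?V x - ?V (m B)))\<^sup>2 + norm (L' B - L)) - B \<bullet> ?P (m B))
      \<longlongrightarrow> (\<mu> - \<gamma> + \<gamma> * (norm (?V x - ?V x))\<^sup>2 + norm (L - L)) - A \<bullet> ?P x) ?F"
    by (intro tendsto_intros L'lim Vlim id tendsto_pure_tensor mlim)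
  then have "\<forall>\<^sub>F B in ?F. (\<mu> - \<gamma> + \<gamma> * (norm (?V x - ?V (m B)))\<^sup>2 + norm (L' B - L)) - B \<bullet> ?P (m B) < 0"
    by (rule order_tendstoD(2)) (simp add: Px \<gamma>)
  moreover have "\<forall>\<^sub>F B in ?F. B \<in> symmetric_tensors" by (simp add: eventually_at_filter)
  ultimately show ?thesis
  proof eventually_elim
    case (elim B)
    let ?\<mu> = "B \<bullet> ?P (m B)"
    have "tensor_Sym (T B) = B"
      by (simp add: T_def linear_add[OF tensor_Sym_linear] linear_diff[OF tensor_Sym_linear] LA
          tensor_Sym_symmetric Asym elim(2))
    note cert = rebalance_certificate[OF this elim(2) m(1) m(3), folded L'_def]
    show ?case
    proof (rule KKT_tensors_plusI[OF _ elim(2) m(1)])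
      show "tensor_Sym (L' B) = B" using cert(1) by (simp add: L'_def)
      show "symmetric_matrix (tensor_Mat (L' B))"
        by (simp add: L'_def symmetric_matrix_mat_symmetrize)
      show "tensor_Mat (L' B) *v ?V (m B) = ?\<mu> *\<^sub>R ?V (m B)"
        using cert(2) by (simp add: L'_def)
      fix w :: "real ^ ('k \<Rightarrow> 'n)"
      assume w: "w \<noteq> 0" "w \<bullet> ?V (m B) = 0"
      \<comment> \<open>The gap of \<open>L\<close> refers to \<open>?V x\<close>, whereas
        \<open>w\<close> is orthogonal to \<open>?V (m B)\<close>; the error is controlled by the
        distance of the two.\<close>
      have "w \<bullet> ?V x = w \<bullet> (?V x - ?V (m B))" using w(2) by (simp add: inner_diff_right)
      then have "(w \<bullet> ?V x)\<^sup>2 \<le> (w \<bullet> w) * (norm (?V x - ?V (m B)))\<^sup>2"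
        using Cauchy_Schwarz_ineq[of w "?V x - ?V (m B)"] by (simp add: power2_norm_eq_inner)
      then have b: "\<gamma> * (w \<bullet> ?V x)\<^sup>2 \<le> \<gamma> * ((w \<bullet> w) * (norm (?V x - ?V (m B)))\<^sup>2)"
        using \<gamma> by simp
      have "w \<bullet> (tensor_Mat (L' B) *v w) = w \<bullet> (tensor_Mat L *v w) + (L' B - L) \<bullet> outer_tensor w w"
        by (simp add: inner_outer_tensor[symmetric] inner_diff_left)
      also have "(L' B - L) \<bullet> outer_tensor w w \<le> norm (L' B - L) * (w \<bullet> w)"
        using norm_cauchy_schwarz[of "L' B - L" "outer_tensor w w"]
        by (simp add: norm_outer_tensor power2_norm_eq_inner power2_eq_square[symmetric])
      also have "w \<bullet> (tensor_Mat L *v w) \<le> \<mu> * (w \<bullet> w) - \<gamma> * (w \<bullet> w - (w \<bullet> ?V x)\<^sup>2)" by (rule gap)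
      also have "\<dots> + norm (L' B - L) * (w \<bullet> w)
          \<le> (\<mu> - \<gamma> + \<gamma> * (norm (?V x - ?V (m B)))\<^sup>2 + norm (L' B - L)) * (w \<bullet> w)"
        using b by (simp add: algebra_simps)
      also have "\<dots> < ?\<mu> * (w \<bullet> w)"
        using elim(1) w(1) by (intro mult_strict_right_mono) auto
      finally show "w \<bullet> (tensor_Mat (L' B) *v w) < ?\<mu> * (w \<bullet> w)" by simp
    qed
  qed
qed

theorem theorem3p6:
  shows "openin (top_of_set (symmetric_tensors :: ('k::finite + 'k, 'n::finite) tensor set))
           (KKT_tensors_plus :: ('k + 'k, 'n) tensor set)"
proof -
  have "KKT_tensors_plus \<subseteq> (symmetric_tensors :: ('k + 'k, 'n) tensor set)"
    by (auto simp: KKT_tensors_plus_def KKT_tensors_def)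
  moreover have "\<exists>e>0. \<forall>B\<in>symmetric_tensors. dist B A < e \<longrightarrow> B \<in> KKT_tensors_plus"
    if "A \<in> KKT_tensors_plus" for A :: "('k + 'k, 'n) tensor"
    \<comment> \<open>The filter leaves out the point \<open>A\<close> itself, whose membership is
      the assumption.\<close>
    using KKT_tensors_plus_eventually[OF that] that unfolding eventually_at by metis
  ultimately show ?thesis unfolding openin_euclidean_subtopology_iff by blast
qed

end
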